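(* Let $\gamma:I\to\mathbb{G}$ be a unit speed Frenet curve with $\tau-\tau_{\mathbb G}\neq0$ on $I$, and let $\gamma^*$ be its conjugate mate in $\mathbb{G}$. Then $\gamma$ and $\gamma^*$ form a Bertrand curve couple in $\mathbb{G}$.
   Context: Let $\mathbb{G}$ be a three-dimensional Lie group with a bi-invariant Riemannian metric $\langle\cdot,\cdot\rangle$, with (oriented) Lie algebra $\mathfrak g$ and Levi-Civita connection $\nabla$; $I\subset\mathbb R$ is an interval and curves are smooth. Vector fields along a curve in $\mathbb G$ are identified with $\mathfrak g$-valued maps by left translation: fixing an orthonormal basis $X_1,X_2,X_3$ of left-invariant fields, write $U=\sum u_iX_i$, and set $U'=\sum u_i'X_i$, $[U,V]=\sum u_iv_j[X_i,X_j]$; then $\nabla_TU=U'+\frac12[T,U]$ with $T=\gamma'$. Vector fields along different curves with the same parameter interval are compared as $\mathfrak g$-valued maps. A unit speed curve $\gamma$ has Frenet-Serret apparatus $\{T,N,B,\kappa,\tau\}$ if $\kappa=\|\nabla_TT\|>0$, $(T,N,B)$ is a positively oriented orthonormal frame, and $\nabla_TT=\kappa N$, $\nabla_TN=-\kappa T+\tau B$, $\nabla_TB=-\tau N$. It is a Frenet curve if moreover $\tau\neq0$. The Lie group torsion is $\tau_{\mathbb G}=\frac12\langle[T,N],B\rangle$. A unit speed curve $\gamma^*:I\to\mathbb G$ with Frenet-Serret apparatus $\{T^*,N^*,B^*,\kappa^*,\tau^*\}$ is the conjugate mate of $\gamma$ if $T^*=B$. Two curves $\gamma,\gamma^*:I\to\mathbb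 G$ form a Bertrand curve couple if their principal normal vector fields are linearly dependent (as elements of $\mathfrak g$) at corresponding points, here points with the same parameter. *)

theory Defs
  imports "HOL-Analysis.Analysis"
begin

section \<open>Smooth maps\<close>

text \<open>
  Derivatives are taken within \<open>S\<close>, so that \<open>S\<close> may be an open set as well as a (relatively open
  subset of a) nondegenerate interval that contains its endpoints. The domain is
  finite-dimensional, hence it suffices to iterate directional derivatives.
\<close>

primrec Ck_on :: "nat \<Rightarrow> 'a::euclidean_space set \<Rightarrow> ('a \<Rightarrow> 'b::real_normed_vector) \<Rightarrow> bool" where
  "Ck_on 0 S f \<longleftrightarrow> continuous_on S f"
| "Ck_on (Suc k) S f \<longleftrightarrow>
     (\<exists>f'. (\<forall>x\<in>S. (f has_derivative f' x) (at x within S)) \<and> (\<forall>v. Ck_on k S (\<lambda>x. f' x v)))"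

definition smooth_on :: "'a::euclidean_space set \<Rightarrow> ('a \<Rightarrow> 'b::real_normed_vector) \<Rightarrow> bool" where
  "smooth_on S f \<longleftrightarrow> (\<forall>k. Ck_on k S f)"


section \<open>Three-dimensional Lie groups\<close>

text \<open>
  The group operation is written additively in order to use the library class of topological
  groups: \<open>p + q\<close> is the product, \<open>- p\<close> the inverse and \<open>0\<close> the identity element. The class
  does not require commutativity. The smooth structure is given by an atlas.
\<close>

type_synonym 'g chart = "'g set \<times> ('g \<Rightarrow> real^3)"

definition smooth_atlas ::
  "'g::{t2_space, second_countable_topology} chart set \<Rightarrow> bool" where
  "smooth_atlas A \<longleftrightarrow>
     (\<forall>(U, \<phi>)\<in>A. open U \<and> open (\<phi> ` U) \<and> homeomorphism U (\<phi> ` U) \<phi> (inv_into U \<phi>)) \<and>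
     (\<Union>(U, \<phi>)\<in>A. U) = UNIV \<and>
     (\<forall>(U, \<phi>)\<in>A. \<forall>(V, \<psi>)\<in>A. smooth_on (\<phi> ` (U \<inter> V)) (\<psi> \<circ> inv_into U \<phi>))"

definition lie_group ::
  "'g::{topological_group_add, t2_space, second_countable_topology} chart set \<Rightarrow> bool" where
  "lie_group A \<longleftrightarrow> smooth_atlas A \<and>
     (\<forall>(U, \<phi>)\<in>A. \<forall>(V, \<psi>)\<in>A. \<forall>(W, \<theta>)\<in>A.
        smooth_on {(x, y). x \<in> \<phi> ` U \<and> y \<in> \<psi> ` V \<and> inv_into U \<phi> x + inv_into V \<psi> y \<in> W}
          (\<lambda>(x, y). \<theta> (inv_into U \<phi> x + inv_into V \<psi> y))) \<and>
     (\<forall>(U, \<phi>)\<in>A. \<forall>(V, \<psi>)\<in>A.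
        smooth_on {x. x \<in> \<phi> ` U \<and> - inv_into U \<phi> x \<in> V} (\<lambda>x. \<psi> (- inv_into U \<phi> x)))"

definition smooth_fun ::
  "'g::topological_space chart set \<Rightarrow> 'g set \<Rightarrow> ('g \<Rightarrow> real) \<Rightarrow> bool" where
  "smooth_fun A P f \<longleftrightarrow> open P \<and> (\<forall>(U, \<phi>)\<in>A. smooth_on (\<phi> ` (U \<inter> P)) (f \<circ> inv_into U \<phi>))"

definition smooth_near ::
  "'g::topological_space chart set \<Rightarrow> 'g \<Rightarrow> ('g \<Rightarrow> real) \<Rightarrow> bool" where
  "smooth_near A p f \<longleftrightarrow> (\<exists>P. p \<in> P \<and> smooth_fun A P f)"

definition smooth_curve ::
  "'g::topological_space chart set \<Rightarrow> real set \<Rightarrow> (real \<Rightarrow> 'g) \<Rightarrow> bool" where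
  "smooth_curve A I c \<longleftrightarrow> continuous_on I c \<and>
     (\<forall>(U, \<phi>)\<in>A. smooth_on {t\<in>I. c t \<in> U} (\<phi> \<circ> c))"


section \<open>Tangent vectors and vector fields\<close>

text \<open>
  A tangent vector at \<open>p\<close> is the velocity at time \<open>0\<close> of a smooth curve through \<open>p\<close>, regarded as
  the operator \<open>f \<mapsto> (f \<circ> c)'(0)\<close> on the functions that are smooth near \<open>p\<close>. On all other
  functions the operator is \<open>0\<close> by convention, so that equality of tangent vectors is equality
  of operators and the vector space operations are the pointwise ones.
\<close>

type_synonym 'g tangent = "('g \<Rightarrow> real) \<Rightarrow> real"
type_synonym 'g vfield = "'g \<Rightarrow> 'g tangent"

definition velocity ::
  "'g::topological_space chart set \<Rightarrow> real set \<Rightarrow> (real \<Rightarrow> 'g) \<Rightarrow> real \<Rightarrow> 'g tangent" where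
  "velocity A I c t =
     (\<lambda>f. if smooth_near A (c t) f then vector_derivative (f \<circ> c) (at t within I) else 0)"

definition tangent_space :: "'g::topological_space chart set \<Rightarrow> 'g \<Rightarrow> 'g tangent set" where
  "tangent_space A p =
     {velocity A {-e<..<e} c 0 | e c. e > 0 \<and> smooth_curve A {-e<..<e} c \<and> c 0 = p}"

definition pushforward ::
  "'g::topological_space chart set \<Rightarrow> ('g \<Rightarrow> 'g) \<Rightarrow> 'g \<Rightarrow> 'g tangent \<Rightarrow> 'g tangent" where
  "pushforward A F p v = (\<lambda>f. if smooth_near A (F p) f then v (f \<circ> F) else 0)"

definition smooth_vfield :: "'g::topological_space chart set \<Rightarrow> 'g vfield \<Rightarrow> bool" where
  "smooth_vfield A X \<longleftrightarrow> (\<forall>p. X p \<in> tangent_space A p) \<and>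
     (\<forall>P f. smooth_fun A P f \<longrightarrow> smooth_fun A P (\<lambda>q. X q f))"

definition lie_bracket ::
  "'g::topological_space chart set \<Rightarrow> 'g vfield \<Rightarrow> 'g vfield \<Rightarrow> 'g vfield" where
  "lie_bracket A X Y = (\<lambda>p f. if smooth_near A p f
     then X p (\<lambda>q. Y q f) - Y p (\<lambda>q. X q f) else 0)"

definition lie_algebra ::
  "'g::{topological_group_add, t2_space, second_countable_topology} chart set \<Rightarrow> 'g vfield set"
  where
  "lie_algebra A =
     {X. smooth_vfield A X \<and> (\<forall>a p. X (a + p) = pushforward A (\<lambda>q. a + q) p (X p))}"


section \<open>Bi-invariant metrics and the Levi-Civita connection\<close>

definition riemannian_metric ::
  "'g::topological_space chart set \<Rightarrow> ('g \<Rightarrow> 'g tangent \<Rightarrow> 'g tangent \<Rightarrow> real) \<Rightarrow> bool" where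
  "riemannian_metric A h \<longleftrightarrow>
     (\<forall>p. \<forall>u\<in>tangent_space A p. \<forall>v\<in>tangent_space A p.
        h p u v = h p v u \<and>
        (\<forall>w\<in>tangent_space A p. \<forall>a b.
           h p (\<lambda>f. a * u f + b * v f) w = a * h p u w + b * h p v w)) \<and>
     (\<forall>p. \<forall>v\<in>tangent_space A p. v \<noteq> (\<lambda>f. 0) \<longrightarrow> h p v v > 0) \<and>
     (\<forall>X Y. smooth_vfield A X \<and> smooth_vfield A Y \<longrightarrow>
        smooth_fun A UNIV (\<lambda>p. h p (X p) (Y p)))"

definition bi_invariant_metric ::
  "'g::{topological_group_add, t2_space, second_countable_topology} chart set \<Rightarrow>
   ('g \<Rightarrow> 'g tangent \<Rightarrow> 'g tangent \<Rightarrow> real) \<Rightarrow> bool" where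
  "bi_invariant_metric A h \<longleftrightarrow> riemannian_metric A h \<and>
     (\<forall>a p. \<forall>u\<in>tangent_space A p. \<forall>v\<in>tangent_space A p.
        h (a + p) (pushforward A (\<lambda>q. a + q) p u) (pushforward A (\<lambda>q. a + q) p v) = h p u v \<and>
        h (p + a) (pushforward A (\<lambda>q. q + a) p u) (pushforward A (\<lambda>q. q + a) p v) = h p u v)"

definition levi_civita ::
  "'g::topological_space chart set \<Rightarrow> ('g \<Rightarrow> 'g tangent \<Rightarrow> 'g tangent \<Rightarrow> real) \<Rightarrow>
   ('g vfield \<Rightarrow> 'g vfield \<Rightarrow> 'g vfield) \<Rightarrow> bool" where
  "levi_civita A h nabla \<longleftrightarrow>
     (\<forall>X Y Z f g. smooth_vfield A X \<and> smooth_vfield A Y \<and> smooth_vfield A Z \<and>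
          smooth_fun A UNIV f \<and> smooth_fun A UNIV g \<longrightarrow>
        smooth_vfield A (nabla X Y) \<and>
        nabla (\<lambda>p \<xi>. f p * X p \<xi> + g p * Y p \<xi>) Z
          = (\<lambda>p \<xi>. f p * nabla X Z p \<xi> + g p * nabla Y Z p \<xi>) \<and>
        nabla X (\<lambda>p \<xi>. Y p \<xi> + Z p \<xi>) = (\<lambda>p \<xi>. nabla X Y p \<xi> + nabla X Z p \<xi>) \<and>
        nabla X (\<lambda>p \<xi>. f p * Y p \<xi>) = (\<lambda>p \<xi>. f p * nabla X Y p \<xi> + X p f * Y p \<xi>) \<and>
        (\<lambda>p \<xi>. nabla X Y p \<xi> - nabla Y X p \<xi>) = lie_bracket A X Y \<and>
        (\<forall>p. X p (\<lambda>q. h q (Y q) (Z q)) = h p (nabla X Y p) (Z p) + h p (Y p) (nabla X Z p)))"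


section \<open>The oriented Euclidean Lie algebra\<close>

text \<open>
  For left-invariant fields the value of a left-invariant metric is the same at every point;
  it is read off at the identity element.
\<close>

definition alg_inner ::
  "('g::zero \<Rightarrow> 'g tangent \<Rightarrow> 'g tangent \<Rightarrow> real) \<Rightarrow> 'g vfield \<Rightarrow> 'g vfield \<Rightarrow> real" where
  "alg_inner h X Y = h 0 (X 0) (Y 0)"

definition orthonormal_basis ::
  "'g::{topological_group_add, t2_space, second_countable_topology} chart set \<Rightarrow>
   ('g \<Rightarrow> 'g tangent \<Rightarrow> 'g tangent \<Rightarrow> real) \<Rightarrow> (3 \<Rightarrow> 'g vfield) \<Rightarrow> bool" where
  "orthonormal_basis A h E \<longleftrightarrow>
     (\<forall>i. E i \<in> lie_algebra A) \<and>
     (\<forall>i j. alg_inner h (E i) (E j) = (if i = j then 1 else 0)) \<and>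
     (\<forall>X\<in>lie_algebra A. \<exists>u. X = (\<lambda>p f. \<Sum>i\<in>UNIV. u i * E i p f))"

definition coords ::
  "('g::zero \<Rightarrow> 'g tangent \<Rightarrow> 'g tangent \<Rightarrow> real) \<Rightarrow> (3 \<Rightarrow> 'g vfield) \<Rightarrow> 'g vfield \<Rightarrow> real^3" where
  "coords h E X = (\<chi> i. alg_inner h X (E i))"

text \<open>The orientation of the Lie algebra is the one for which the ordered basis \<open>E\<close> is positive.\<close>

definition positively_oriented ::
  "('g::zero \<Rightarrow> 'g tangent \<Rightarrow> 'g tangent \<Rightarrow> real) \<Rightarrow> (3 \<Rightarrow> 'g vfield) \<Rightarrow>
   'g vfield \<Rightarrow> 'g vfield \<Rightarrow> 'g vfield \<Rightarrow> bool" where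
  "positively_oriented h E X Y Z \<longleftrightarrow>
     det (vector [coords h E X, coords h E Y, coords h E Z] :: real^3^3) > 0"

definition lin_dependent :: "'g vfield \<Rightarrow> 'g vfield \<Rightarrow> bool" where
  "lin_dependent X Y \<longleftrightarrow>
     (\<exists>a b. (a, b) \<noteq> (0, 0) \<and> (\<lambda>p f. a * X p f + b * Y p f) = (\<lambda>p f. 0))"


section \<open>Frenet curves\<close>

text \<open>
  A vector field along a curve is given, via left translation, as a map \<open>U\<close> from the parameter
  interval to the Lie algebra; its value at the parameter \<open>t\<close> is the tangent vector
  \<open>U t (\<gamma> t)\<close>. For \<open>U = (\<Sum>i. u\<^sub>i E\<^sub>i)\<close> the covariant derivative along \<open>\<gamma>\<close> is
  \<open>(\<Sum>i. u\<^sub>i' E\<^sub>i + u\<^sub>i \<nabla>\<^sub>T E\<^sub>i)\<close>, evaluated at \<open>\<gamma> t\<close>, where \<open>T\<close> is the left-invariant field that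
  represents \<open>\<gamma>' t\<close>. By \<open>\<nabla>\<^sub>X Y = [X, Y] / 2\<close> for left-invariant \<open>X\<close> and \<open>Y\<close>, this is
  \<open>U' + [T, U] / 2\<close>.
\<close>

definition cov_deriv ::
  "('g::zero \<Rightarrow> 'g tangent \<Rightarrow> 'g tangent \<Rightarrow> real) \<Rightarrow>
   ('g vfield \<Rightarrow> 'g vfield \<Rightarrow> 'g vfield) \<Rightarrow> (3 \<Rightarrow> 'g vfield) \<Rightarrow> real set \<Rightarrow>
   (real \<Rightarrow> 'g) \<Rightarrow> (real \<Rightarrow> 'g vfield) \<Rightarrow> (real \<Rightarrow> 'g vfield) \<Rightarrow> real \<Rightarrow> 'g tangent" where
  "cov_deriv h nabla E I \<gamma> T U t = (\<lambda>f. \<Sum>i\<in>UNIV.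
     vector_derivative (\<lambda>s. coords h E (U s) $ i) (at t within I) * E i (\<gamma> t) f
     + coords h E (U t) $ i * nabla (T t) (E i) (\<gamma> t) f)"

record 'g frenet =
  tangent :: "real \<Rightarrow> 'g vfield"
  normal :: "real \<Rightarrow> 'g vfield"
  binormal :: "real \<Rightarrow> 'g vfield"
  curvature :: "real \<Rightarrow> real"
  torsion :: "real \<Rightarrow> real"

definition frenet_apparatus ::
  "'g::{topological_group_add, t2_space, second_countable_topology} chart set \<Rightarrow>
   ('g \<Rightarrow> 'g tangent \<Rightarrow> 'g tangent \<Rightarrow> real) \<Rightarrow>
   ('g vfield \<Rightarrow> 'g vfield \<Rightarrow> 'g vfield) \<Rightarrow> (3 \<Rightarrow> 'g vfield) \<Rightarrow>
   real set \<Rightarrow> (real \<Rightarrow> 'g) \<Rightarrow> 'g frenet \<Rightarrow> bool" where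
  "frenet_apparatus A h nabla E I \<gamma> F \<longleftrightarrow>
     (let T = tangent F; N = normal F; B = binormal F; \<kappa> = curvature F; \<tau> = torsion F;
          D = cov_deriv h nabla E I \<gamma> T
      in smooth_curve A I \<gamma> \<and>
         (\<forall>V\<in>{T, N, B}. (\<forall>t\<in>I. V t \<in> lie_algebra A) \<and> smooth_on I (\<lambda>t. coords h E (V t))) \<and>
         (\<forall>t\<in>I.
            T t (\<gamma> t) = velocity A I \<gamma> t \<and>
            sqrt (h (\<gamma> t) (velocity A I \<gamma> t) (velocity A I \<gamma> t)) = 1 \<and>
            \<kappa> t = sqrt (h (\<gamma> t) (D T t) (D T t)) \<and> \<kappa> t > 0 \<and>
            alg_inner h (T t) (T t) = 1 \<and> alg_inner h (N t) (N t) = 1 \<and>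
            alg_inner h (B t) (B t) = 1 \<and> alg_inner h (T t) (N t) = 0 \<and>
            alg_inner h (T t) (B t) = 0 \<and> alg_inner h (N t) (B t) = 0 \<and>
            positively_oriented h E (T t) (N t) (B t) \<and>
            D T t = (\<lambda>f. \<kappa> t * N t (\<gamma> t) f) \<and>
            D N t = (\<lambda>f. - \<kappa> t * T t (\<gamma> t) f + \<tau> t * B t (\<gamma> t) f) \<and>
            D B t = (\<lambda>f. - \<tau> t * N t (\<gamma> t) f)))"

definition frenet_curve ::
  "'g::{topological_group_add, t2_space, second_countable_topology} chart set \<Rightarrow>
   ('g \<Rightarrow> 'g tangent \<Rightarrow> 'g tangent \<Rightarrow> real) \<Rightarrow>
   ('g vfield \<Rightarrow> 'g vfield \<Rightarrow> 'g vfield) \<Rightarrow> (3 \<Rightarrow> 'g vfield) \<Rightarrow>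
   real set \<Rightarrow> (real \<Rightarrow> 'g) \<Rightarrow> 'g frenet \<Rightarrow> bool" where
  "frenet_curve A h nabla E I \<gamma> F \<longleftrightarrow>
     frenet_apparatus A h nabla E I \<gamma> F \<and> (\<forall>t\<in>I. torsion F t \<noteq> 0)"

definition lie_torsion ::
  "'g::{topological_group_add, t2_space, second_countable_topology} chart set \<Rightarrow>
   ('g \<Rightarrow> 'g tangent \<Rightarrow> 'g tangent \<Rightarrow> real) \<Rightarrow> 'g frenet \<Rightarrow> real \<Rightarrow> real" where
  "lie_torsion A h F t =
     1 / 2 * alg_inner h (lie_bracket A (tangent F t) (normal F t)) (binormal F t)"

definition conjugate_mate ::
  "'g::{topological_group_add, t2_space, second_countable_topology} chart set \<Rightarrow>
   ('g \<Rightarrow> 'g tangent \<Rightarrow> 'g tangent \<Rightarrow> real) \<Rightarrow>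
   ('g vfield \<Rightarrow> 'g vfield \<Rightarrow> 'g vfield) \<Rightarrow> (3 \<Rightarrow> 'g vfield) \<Rightarrow>
   real set \<Rightarrow> 'g frenet \<Rightarrow> (real \<Rightarrow> 'g) \<Rightarrow> 'g frenet \<Rightarrow> bool" where
  "conjugate_mate A h nabla E I F \<gamma>' F' \<longleftrightarrow>
     frenet_apparatus A h nabla E I \<gamma>' F' \<and> (\<forall>t\<in>I. tangent F' t = binormal F t)"

definition bertrand_couple ::
  "'g::{topological_group_add, t2_space, second_countable_topology} chart set \<Rightarrow>
   ('g \<Rightarrow> 'g tangent \<Rightarrow> 'g tangent \<Rightarrow> real) \<Rightarrow>
   ('g vfield \<Rightarrow> 'g vfield \<Rightarrow> 'g vfield) \<Rightarrow> (3 \<Rightarrow> 'g vfield) \<Rightarrow> real set \<Rightarrow>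
   (real \<Rightarrow> 'g) \<Rightarrow> 'g frenet \<Rightarrow> (real \<Rightarrow> 'g) \<Rightarrow> 'g frenet \<Rightarrow> bool" where
  "bertrand_couple A h nabla E I \<gamma> F \<gamma>' F' \<longleftrightarrow>
     frenet_apparatus A h nabla E I \<gamma> F \<and> frenet_apparatus A h nabla E I \<gamma>' F' \<and>
     (\<forall>t\<in>I. lin_dependent (normal F t) (normal F' t))"

end

theory Submission
  imports Defs
begin

text \<open>
  The whole content is that \<open>\<nabla>\<^sub>Y Y = 0\<close> for left-invariant \<open>Y\<close> when the metric is bi-invariant
  (lemma \<open>nabla_self_eq_zero\<close>). Write \<open>B'\<close> for the derivative of the coordinates of the binormal.
  The third Frenet equation of \<open>\<gamma>\<close> says \<open>B' = - \<tau> N - \<nabla>\<^sub>T B\<close>. Left-invariant fields have constant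
  inner products, so \<open>\<langle>\<nabla>\<^sub>T B, B\<rangle> = 0\<close> and \<open>\<langle>\<nabla>\<^sub>T B, T\<rangle> = - \<langle>B, \<nabla>\<^sub>T T\<rangle> = 0\<close>; hence \<open>B'\<close> is a multiple of
  \<open>N\<close>. For the mate, \<open>T\<^sup>* = B\<close>, so the first Frenet equation reads
  \<open>\<kappa>\<^sup>* N\<^sup>* = B' + \<nabla>\<^sub>B B = B'\<close>. Since \<open>\<kappa>\<^sup>* > 0\<close>, the normals are linearly dependent.

  The usual proof that \<open>\<nabla>\<^sub>Y Y = 0\<close> differentiates the adjoint representation along one-parameter
  subgroups. Flows and the exponential map are avoided here: at a given point \<open>Y\<close> is
  compared with the right-invariant field that has the same value there. That field has constant
  length, and it commutes with left-invariant fields because mixed second derivatives of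
  \<open>f (x - p + y)\<close> are symmetric (lemmas \<open>mixed_derivatives_commute\<close> and
  \<open>left_right_invariant_commute\<close>). Together with the vanishing of torsion this gives the claim.

  The remaining work is to make the operators that represent tangent vectors computable. In a chart
  each of them is a directional derivative (\<open>tangent_space_eq_chart_vectors\<close>), which shows that they
  form a vector space, that the left-invariant orthonormal fields span it at every point
  (\<open>frame_expansion\<close>), and that right-invariant fields are smooth.
\<close>

section \<open>Calculus of smooth maps\<close>

lemma Ck_on_cong:
  assumes "\<And>x. x \<in> S \<Longrightarrow> f x = g x"
  shows "Ck_on k S f \<longleftrightarrow> Ck_on k S g"
proof (cases k)
  case 0
  then show ?thesis using assms by (simp cong: continuous_on_cong)
next
  case (Suc n)
  have "(f has_derivative D) (at x within S) \<longleftrightarrow> (g has_derivative D) (at x within S)"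
    if "x \<in> S" for x D
    using that assms by (metis has_derivative_transform)
  then show ?thesis unfolding Suc by simp
qed

lemma Ck_on_subset: "Ck_on k S f \<Longrightarrow> T \<subseteq> S \<Longrightarrow> Ck_on k T f"
proof (induction k arbitrary: f)
  case 0
  then show ?case by (auto intro: continuous_on_subset)
next
  case (Suc k)
  then show ?case
    by (simp, metis has_derivative_subset subsetD)
qed

lemma Ck_on_SucD: "Ck_on (Suc k) S f \<Longrightarrow> Ck_on k S f"
proof (induction k arbitrary: f)
  case 0
  then show ?case
    by (auto intro: has_derivative_continuous_on)
next
  case (Suc k)
  from Suc.prems obtain f' where
    "\<forall>x\<in>S. (f has_derivative f' x) (at x within S)" "\<forall>v. Ck_on (Suc k) S (\<lambda>x. f' x v)"
    by (subst (asm) Ck_on.simps) blast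
  then show ?case using Suc.IH by (auto simp del: Ck_on.simps simp add: Ck_on.simps(2)[of k])
qed

lemma Ck_on_const: "Ck_on k S (\<lambda>x. c)"
proof (induction k arbitrary: c)
  case (Suc k)
  then show ?case
    by (simp, intro exI[of _ "\<lambda>x v. 0"]) auto
qed simp

lemma Ck_on_bounded_linear:
  assumes "bounded_linear L"
  shows "Ck_on k S f \<Longrightarrow> Ck_on k S (\<lambda>x. L (f x))"
proof (induction k arbitrary: f)
  case 0
  then show ?case
    using assms by (auto intro: bounded_linear.continuous_on)
next
  case (Suc k)
  then obtain f' where f': "\<forall>x\<in>S. (f has_derivative f' x) (at x within S)"
    "\<forall>v. Ck_on k S (\<lambda>x. f' x v)"
    by auto
  then show ?case using Suc.IH
    by (simp, intro exI[of _ "\<lambda>x v. L (f' x v)"])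
       (auto intro: bounded_linear.has_derivative[OF assms])
qed

lemma Ck_on_linear: "bounded_linear L \<Longrightarrow> Ck_on k S L"
proof (cases k)
  case 0
  assume "bounded_linear L"
  then show ?thesis unfolding 0 by (simp add: linear_continuous_on)
next
  case (Suc n)
  assume "bounded_linear L"
  then show ?thesis unfolding Suc
    by (simp, intro exI[of _ "\<lambda>x. L"]) (auto simp: bounded_linear_imp_has_derivative Ck_on_const)
qed

lemma Ck_on_add: "Ck_on k S f \<Longrightarrow> Ck_on k S g \<Longrightarrow> Ck_on k S (\<lambda>x. f x + g x)"
proof (induction k arbitrary: f g)
  case 0
  then show ?case by (auto intro: continuous_on_add)
next
  case (Suc k)
  obtain f' where f': "\<forall>x\<in>S. (f has_derivative f' x) (at x within S)"
    "\<forall>v. Ck_on k S (\<lambda>x. f' x v)"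
    using Suc.prems by auto
  obtain g' where g': "\<forall>x\<in>S. (g has_derivative g' x) (at x within S)"
    "\<forall>v. Ck_on k S (\<lambda>x. g' x v)"
    using Suc.prems by auto
  show ?case using Suc.IH f' g'
    by (simp, intro exI[of _ "\<lambda>x v. f' x v + g' x v"])
       (auto intro: has_derivative_add)
qed

lemma Ck_on_sum:
  "(\<And>i. i \<in> J \<Longrightarrow> Ck_on k S (f i)) \<Longrightarrow> Ck_on k S (\<lambda>x. \<Sum>i\<in>J. f i x)"
proof (induction J rule: infinite_finite_induct)
  case (insert i J)
  have "Ck_on k S (\<lambda>x. f i x + (\<Sum>i\<in>J. f i x))"
    by (rule Ck_on_add) (use insert in blast)+
  then show ?case by (simp only: sum.insert[OF insert(1,2)])
qed (simp_all only: sum.infinite sum.empty Ck_on_const not_False_eq_True)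

lemma Ck_on_scaleR: "Ck_on k S f \<Longrightarrow> Ck_on k S g \<Longrightarrow> Ck_on k S (\<lambda>x. f x *\<^sub>R g x)"
proof (induction k arbitrary: f g)
  case 0
  then show ?case by (auto intro: continuous_on_scaleR)
next
  case (Suc k)
  obtain f' where f': "\<forall>x\<in>S. (f has_derivative f' x) (at x within S)"
    "\<forall>v. Ck_on k S (\<lambda>x. f' x v)"
    using Suc.prems by auto
  obtain g' where g': "\<forall>x\<in>S. (g has_derivative g' x) (at x within S)"
    "\<forall>v. Ck_on k S (\<lambda>x. g' x v)"
    using Suc.prems by auto
  have "Ck_on k S f" "Ck_on k S g"
    using Suc.prems Ck_on_SucD by blast+
  then show ?case using Suc.IH f' g'
    by (simp, intro exI[of _ "\<lambda>x v. f x *\<^sub>R g' x v + f' x v *\<^sub>R g x"])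
       (auto intro: has_derivative_scaleR Ck_on_add)
qed

text \<open>The predicate \<open>Ck_on\<close> records directional derivatives only, so the derivative of \<open>g \<circ> f\<close> in
  direction \<open>v\<close> has to be written with fixed directions of \<open>g\<close>: it is the combination of the
  partial derivatives of \<open>g\<close> along the basis, with the coordinates of the derivative of \<open>f\<close> as
  coefficients. The induction hypothesis applies to each of these partial derivatives.\<close>

lemma Ck_on_compose:
  fixes f :: "'a::euclidean_space \<Rightarrow> 'b::euclidean_space"
    and g :: "'b \<Rightarrow> 'c::real_normed_vector"
  shows "Ck_on k T g \<Longrightarrow> Ck_on k S f \<Longrightarrow> f ` S \<subseteq> T \<Longrightarrow> Ck_on k S (\<lambda>x. g (f x))"
proof (induction k arbitrary: g)
  case 0
  then show ?case by (auto intro: continuous_on_compose2)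
next
  case (Suc k)
  obtain f' where f': "\<forall>x\<in>S. (f has_derivative f' x) (at x within S)"
    "\<forall>v. Ck_on k S (\<lambda>x. f' x v)"
    using Suc.prems by auto
  obtain g' where g': "\<forall>x\<in>T. (g has_derivative g' x) (at x within T)"
    "\<forall>v. Ck_on k T (\<lambda>x. g' x v)"
    using Suc.prems by auto
  have fk: "Ck_on k S f"
    using Suc.prems Ck_on_SucD by blast
  have d: "((\<lambda>x. g (f x)) has_derivative (\<lambda>v. g' (f x) (f' x v))) (at x within S)"
    if "x \<in> S" for x
    using that f' g' Suc.prems by (intro has_derivative_in_compose2[of T g g' f S x]) auto
  have "Ck_on k S (\<lambda>x. g' (f x) (f' x v))" for v
  proof -
    have "Ck_on k S (\<lambda>x. \<Sum>b\<in>Basis. (f' x v \<bullet> b) *\<^sub>R g' (f x) b)"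
      using f' g' fk Suc.prems
      by (intro Ck_on_sum Ck_on_scaleR Ck_on_bounded_linear[OF bounded_linear_inner_left]
            Suc.IH[of "\<lambda>y. g' y _"]) auto
    moreover have "g' (f x) (f' x v) = (\<Sum>b\<in>Basis. (f' x v \<bullet> b) *\<^sub>R g' (f x) b)" if "x \<in> S" for x
    proof -
      have "linear (g' (f x))"
        using that g' Suc.prems by (auto dest: has_derivative_linear)
      then show ?thesis
        by (subst euclidean_representation[of "f' x v", symmetric])
           (simp add: linear_sum linear_scale del: euclidean_representation)
    qed
    ultimately show ?thesis by (subst Ck_on_cong) auto
  qed
  with d show ?case
    unfolding Ck_on.simps by (intro exI[of _ "\<lambda>x v. g' (f x) (f' x v)"]) blast
qed

text \<open>On an open set derivatives are unique, so the derivative demanded by the definition is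
  \<open>frechet_derivative\<close>, for every order at once. On other sets the witnesses for different orders
  need not agree. This is what makes smoothness local (next lemma) and lets a smooth map be
  differentiated to a smooth map.\<close>

lemma Ck_on_Suc_open:
  assumes "open S"
  shows "Ck_on (Suc k) S f \<longleftrightarrow>
    (\<forall>x\<in>S. f differentiable (at x)) \<and> (\<forall>v. Ck_on k S (\<lambda>x. frechet_derivative f (at x) v))"
    (is "?l \<longleftrightarrow> ?r")
proof
  assume ?l
  then obtain f' where f': "\<forall>x\<in>S. (f has_derivative f' x) (at x within S)"
    "\<forall>v. Ck_on k S (\<lambda>x. f' x v)"
    by auto
  have d: "(f has_derivative f' x) (at x)" if "x \<in> S" for x
    using f'(1) that at_within_open[OF that assms] by auto
  have "Ck_on k S (\<lambda>x. frechet_derivative f (at x) v)" for v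
  proof -
    have "frechet_derivative f (at x) v = f' x v" if "x \<in> S" for x
      using frechet_derivative_at[OF d[OF that]] by simp
    then show ?thesis
      using f'(2) Ck_on_cong[of S "\<lambda>x. frechet_derivative f (at x) v" "\<lambda>x. f' x v"] by blast
  qed
  then show ?r using d differentiable_def by blast
next
  assume ?r
  then show ?l
    by (simp, intro exI[of _ "\<lambda>x. frechet_derivative f (at x)"])
       (auto simp: frechet_derivative_works intro: has_derivative_at_withinI)
qed

lemma Ck_on_local:
  assumes "open S"
  shows "(\<And>x. x \<in> S \<Longrightarrow> \<exists>N. open N \<and> x \<in> N \<and> Ck_on k (S \<inter> N) f) \<Longrightarrow> Ck_on k S f"
proof (induction k arbitrary: f)
  case 0
  have "continuous (at x) f" if x: "x \<in> S" for x
  proof -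
    obtain N where "open N" "x \<in> N" "continuous_on (S \<inter> N) f"
      using 0[OF x] by auto
    then show ?thesis
      using x assms continuous_on_eq_continuous_at[of "S \<inter> N" f] by auto
  qed
  then show ?case by (simp add: continuous_at_imp_continuous_on)
next
  case (Suc k)
  have loc: "\<exists>N. open N \<and> x \<in> N \<and> (\<forall>y\<in>S \<inter> N. f differentiable (at y)) \<and>
      (\<forall>v. Ck_on k (S \<inter> N) (\<lambda>y. frechet_derivative f (at y) v))" if x: "x \<in> S" for x
  proof -
    obtain N where N: "open N" "x \<in> N" "Ck_on (Suc k) (S \<inter> N) f"
      using Suc.prems[OF x] by blast
    have "open (S \<inter> N)" using N(1) assms by blast
    then show ?thesis using N Ck_on_Suc_open[of "S \<inter> N" k f] by blast
  qed
  show ?case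
    unfolding Ck_on_Suc_open[OF assms]
  proof (intro conjI ballI allI)
    show "f differentiable (at x)" if "x \<in> S" for x
      using loc[OF that] that by blast
    show "Ck_on k S (\<lambda>x. frechet_derivative f (at x) v)" for v
      by (rule Suc.IH) (use loc in blast)
  qed
qed

lemma smooth_on_cong: "(\<And>x. x \<in> S \<Longrightarrow> f x = g x) \<Longrightarrow> smooth_on S f \<longleftrightarrow> smooth_on S g"
  unfolding smooth_on_def using Ck_on_cong by metis

lemma smooth_on_subset: "smooth_on S f \<Longrightarrow> T \<subseteq> S \<Longrightarrow> smooth_on T f"
  unfolding smooth_on_def using Ck_on_subset by blast

lemma smooth_on_const: "smooth_on S (\<lambda>x. c)"
  unfolding smooth_on_def using Ck_on_const by blast

lemma smooth_on_linear: "bounded_linear L \<Longrightarrow> smooth_on S L"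
  unfolding smooth_on_def using Ck_on_linear by blast

lemma smooth_on_add: "smooth_on S f \<Longrightarrow> smooth_on S g \<Longrightarrow> smooth_on S (\<lambda>x. f x + g x)"
  unfolding smooth_on_def using Ck_on_add by blast

lemma smooth_on_mult:
  fixes f g :: "'a::euclidean_space \<Rightarrow> real"
  shows "smooth_on S f \<Longrightarrow> smooth_on S g \<Longrightarrow> smooth_on S (\<lambda>x. f x * g x)"
  unfolding smooth_on_def using Ck_on_scaleR[of _ S f g] by simp

lemma smooth_on_Pair:
  assumes "smooth_on S f" "smooth_on S g"
  shows "smooth_on S (\<lambda>x. (f x, g x))"
proof -
  have 1: "bounded_linear (\<lambda>x. (x, 0))" "bounded_linear (\<lambda>x. (0, x))"
    by (auto intro!: bounded_linear_Pair bounded_linear_ident bounded_linear_zero)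
  have "Ck_on k S (\<lambda>x. (f x, 0) + (0, g x))" for k
    using assms unfolding smooth_on_def
    by (intro Ck_on_add Ck_on_bounded_linear[OF 1(1)] Ck_on_bounded_linear[OF 1(2)]) auto
  then show ?thesis by (simp add: smooth_on_def)
qed

lemma smooth_on_compose:
  fixes f :: "'a::euclidean_space \<Rightarrow> 'b::euclidean_space"
  assumes "smooth_on T g" "smooth_on S f" "f ` S \<subseteq> T"
  shows "smooth_on S (\<lambda>x. g (f x))"
  using assms Ck_on_compose unfolding smooth_on_def by blast

lemma smooth_on_local:
  assumes "open S" "\<And>x. x \<in> S \<Longrightarrow> \<exists>N. open N \<and> x \<in> N \<and> smooth_on (S \<inter> N) f"
  shows "smooth_on S f"
  unfolding smooth_on_def
proof
  show "Ck_on k S f" for k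
    by (rule Ck_on_local[OF assms(1)]) (metis assms(2) smooth_on_def)
qed

lemma smooth_on_continuous: "smooth_on S f \<Longrightarrow> continuous_on S f"
  unfolding smooth_on_def by (metis Ck_on.simps(1))

lemma smooth_on_differentiable:
  "smooth_on S f \<Longrightarrow> open S \<Longrightarrow> x \<in> S \<Longrightarrow> f differentiable (at x)"
  unfolding smooth_on_def by (metis Ck_on_Suc_open)

lemma smooth_on_frechet_derivative:
  "smooth_on S f \<Longrightarrow> open S \<Longrightarrow> smooth_on S (\<lambda>x. frechet_derivative f (at x) v)"
  unfolding smooth_on_def by (metis Ck_on_Suc_open)

lemma frechet_derivative_compose_at:
  assumes "g differentiable (at (f x))" "(f has_derivative f') (at x)"
  shows "frechet_derivative (\<lambda>y. g (f y)) (at x) v = frechet_derivative g (at (f x)) (f' v)"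
proof -
  have "((\<lambda>y. g (f y)) has_derivative (\<lambda>v. frechet_derivative g (at (f x)) (f' v))) (at x)"
    using has_derivative_compose[OF assms(2)] assms(1) by (simp add: frechet_derivative_works)
  then show ?thesis using frechet_derivative_at by metis
qed

lemma frechet_derivative_fst:
  assumes "F differentiable (at (x, y))"
  shows "frechet_derivative (\<lambda>x. F (x, y)) (at x) w = frechet_derivative F (at (x, y)) (w, 0)"
  by (rule frechet_derivative_compose_at[of F "\<lambda>x. (x, y)" x "\<lambda>h. (h, 0)"])
     (auto intro!: assms derivative_eq_intros)

lemma frechet_derivative_snd:
  assumes "F differentiable (at (x, y))"
  shows "frechet_derivative (\<lambda>y. F (x, y)) (at y) w = frechet_derivative F (at (x, y)) (0, w)"
  by (rule frechet_derivative_compose_at[of F "\<lambda>y. (x, y)" y "\<lambda>h. (0, h)"])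
     (auto intro!: assms derivative_eq_intros)

text \<open>The mean value theorem is applied first along \<open>a\<close>, to the difference of \<open>F\<close> on two opposite
  sides of the parallelogram, and then along \<open>b\<close>, to the derivative of \<open>F\<close> in direction \<open>a\<close>.\<close>

lemma second_difference_mean_value:
  fixes F :: "'a::euclidean_space \<Rightarrow> real"
  assumes F: "smooth_on S F" and S: "open S" and r: "r > 0"
    and sub: "\<And>s t. s \<in> {0..r} \<Longrightarrow> t \<in> {0..r} \<Longrightarrow> z + s *\<^sub>R a + t *\<^sub>R b \<in> S"
  shows "\<exists>s\<in>{0..r}. \<exists>t\<in>{0..r}.
    F (z + r *\<^sub>R a + r *\<^sub>R b) - F (z + r *\<^sub>R a) - F (z + r *\<^sub>R b) + F z =
    r * r * frechet_derivative (\<lambda>x. frechet_derivative F (at x) a) (at (z + s *\<^sub>R a + t *\<^sub>R b)) b"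
proof -
  define G where "G = (\<lambda>x. frechet_derivative F (at x) a)"
  have G: "smooth_on S G"
    unfolding G_def by (rule smooth_on_frechet_derivative[OF F S])
  have dF: "(F has_derivative frechet_derivative F (at x)) (at x)" if "x \<in> S" for x
    using smooth_on_differentiable[OF F S that] by (simp add: frechet_derivative_works)
  have dG: "(G has_derivative frechet_derivative G (at x)) (at x)" if "x \<in> S" for x
    using smooth_on_differentiable[OF G S that] by (simp add: frechet_derivative_works)
  have lin: "frechet_derivative F (at x) (c *\<^sub>R v) = c * frechet_derivative F (at x) v"
    if "x \<in> S" for x c v
    using linear_scale[OF has_derivative_linear[OF dF[OF that]]] by simp
  have linG: "frechet_derivative G (at x) (c *\<^sub>R v) = c * frechet_derivative G (at x) v"
    if "x \<in> S" for x c v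
    using linear_scale[OF has_derivative_linear[OF dG[OF that]]] by simp
  define \<phi> where "\<phi> = (\<lambda>s. F (z + s *\<^sub>R a + r *\<^sub>R b) - F (z + s *\<^sub>R a))"
  have "\<exists>s\<in>{0<..<r}. \<phi> r - \<phi> 0 =
      (\<lambda>h. frechet_derivative F (at (z + s *\<^sub>R a + r *\<^sub>R b)) (h *\<^sub>R a)
        - frechet_derivative F (at (z + s *\<^sub>R a)) (h *\<^sub>R a)) (r - 0)"
  proof (rule mvt_simple[OF r])
    fix s assume s: "0 \<le> s" "s \<le> r"
    have in1: "z + s *\<^sub>R a + r *\<^sub>R b \<in> S" using sub[of s r] s r by simp
    have in2: "z + s *\<^sub>R a \<in> S" using sub[of s 0] s r by simp
    show "(\<phi> has_derivative (\<lambda>h. frechet_derivative F (at (z + s *\<^sub>R a + r *\<^sub>R b)) (h *\<^sub>R a)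
        - frechet_derivative F (at (z + s *\<^sub>R a)) (h *\<^sub>R a))) (at s within {0..r})"
      unfolding \<phi>_def
      by (intro has_derivative_diff has_derivative_compose[of "\<lambda>s. z + s *\<^sub>R a + r *\<^sub>R b" "\<lambda>h. h *\<^sub>R a" s _ F, OF _ dF[OF in1]]
          has_derivative_compose[of "\<lambda>s. z + s *\<^sub>R a" "\<lambda>h. h *\<^sub>R a" s _ F, OF _ dF[OF in2]]) (auto intro!: derivative_eq_intros)
  qed
  then obtain s where s: "s \<in> {0<..<r}" and 1: "\<phi> r - \<phi> 0 =
      frechet_derivative F (at (z + s *\<^sub>R a + r *\<^sub>R b)) (r *\<^sub>R a)
        - frechet_derivative F (at (z + s *\<^sub>R a)) (r *\<^sub>R a)"
    by auto
  have "z + s *\<^sub>R a + r *\<^sub>R b \<in> S" "z + s *\<^sub>R a \<in> S"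
    using sub[of s r] sub[of s 0] s r by auto
  then have 1: "\<phi> r - \<phi> 0 = r * (G (z + s *\<^sub>R a + r *\<^sub>R b) - G (z + s *\<^sub>R a))"
    by (simp add: 1 lin G_def algebra_simps)
  have "\<exists>t\<in>{0<..<r}. G (z + s *\<^sub>R a + r *\<^sub>R b) - G (z + s *\<^sub>R a + 0 *\<^sub>R b) =
      (\<lambda>h. frechet_derivative G (at (z + s *\<^sub>R a + t *\<^sub>R b)) (h *\<^sub>R b)) (r - 0)"
  proof (rule mvt_simple[OF r, of "\<lambda>t. G (z + s *\<^sub>R a + t *\<^sub>R b)"])
    fix t assume t: "0 \<le> t" "t \<le> r"
    have in1: "z + s *\<^sub>R a + t *\<^sub>R b \<in> S" using sub[of s t] s t by simp
    show "((\<lambda>t. G (z + s *\<^sub>R a + t *\<^sub>R b)) has_derivative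
        (\<lambda>h. frechet_derivative G (at (z + s *\<^sub>R a + t *\<^sub>R b)) (h *\<^sub>R b))) (at t within {0..r})"
      by (intro has_derivative_compose[of "\<lambda>t. z + s *\<^sub>R a + t *\<^sub>R b" "\<lambda>h. h *\<^sub>R b" t _ G, OF _ dG[OF in1]]) (auto intro!: derivative_eq_intros)
  qed
  then obtain t where t: "t \<in> {0<..<r}" and
    2: "G (z + s *\<^sub>R a + r *\<^sub>R b) - G (z + s *\<^sub>R a) =
      frechet_derivative G (at (z + s *\<^sub>R a + t *\<^sub>R b)) (r *\<^sub>R b)"
    by auto
  have "z + s *\<^sub>R a + t *\<^sub>R b \<in> S" using sub[of s t] s t by auto
  then have "\<phi> r - \<phi> 0 = r * r * frechet_derivative G (at (z + s *\<^sub>R a + t *\<^sub>R b)) b"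
    by (simp add: 1 2 linG)
  then show ?thesis
    using s t unfolding \<phi>_def G_def
    by (intro bexI[of _ s] bexI[of _ t]) auto
qed

text \<open>The left-hand side of the previous lemma is symmetric in \<open>a\<close> and \<open>b\<close>. Hence each small
  parallelogram contains two points at which the two mixed derivatives agree, and continuity carries
  the equality to the corner \<open>z\<close>.\<close>

lemma mixed_derivatives_commute:
  fixes F :: "'a::euclidean_space \<Rightarrow> real"
  assumes F: "smooth_on S F" and S: "open S" and z: "z \<in> S"
  shows "frechet_derivative (\<lambda>x. frechet_derivative F (at x) a) (at z) b =
         frechet_derivative (\<lambda>x. frechet_derivative F (at x) b) (at z) a"
proof -
  define H where "H = (\<lambda>a b x. frechet_derivative (\<lambda>x. frechet_derivative F (at x) a) (at x) b)"
  have cont: "continuous (at z) (H a b)" for a b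
  proof -
    have "continuous_on S (H a b)"
      unfolding H_def
      by (intro smooth_on_continuous smooth_on_frechet_derivative F S)
    then show ?thesis using continuous_on_eq_continuous_at[OF S] z by blast
  qed
  have "\<bar>H a b z - H b a z\<bar> < 2 * e" if e: "e > 0" for e
  proof -
    obtain d1 where d1: "d1 > 0" "\<And>y. dist y z < d1 \<Longrightarrow> dist (H a b y) (H a b z) < e"
      using cont[of a b] e unfolding continuous_at_eps_delta by blast
    obtain d2 where d2: "d2 > 0" "\<And>y. dist y z < d2 \<Longrightarrow> dist (H b a y) (H b a z) < e"
      using cont[of b a] e unfolding continuous_at_eps_delta by blast
    obtain d3 where d3: "d3 > 0" "ball z d3 \<subseteq> S"
      using S z open_contains_ball by blast
    define d where "d = min d1 (min d2 d3)"
    define r where "r = d / (2 * (norm a + norm b + 1))"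
    have d: "d > 0" using d1 d2 d3 by (simp add: d_def)
    have nn: "norm a + norm b + 1 > 0" using norm_ge_zero[of a] norm_ge_zero[of b] by linarith
    then have r: "r > 0" using d by (simp add: r_def)
    have near: "dist (z + s *\<^sub>R a + t *\<^sub>R b) z < d" if "s \<in> {0..r}" "t \<in> {0..r}" for s t
    proof -
      have "dist (z + s *\<^sub>R a + t *\<^sub>R b) z = norm (s *\<^sub>R a + t *\<^sub>R b)"
        by (simp add: dist_norm algebra_simps)
      also have "\<dots> \<le> s * norm a + t * norm b"
        using that norm_triangle_ineq[of "s *\<^sub>R a" "t *\<^sub>R b"] by simp
      also have "\<dots> \<le> r * norm a + r * norm b"
        using that by (intro add_mono mult_right_mono) auto
      also have "\<dots> \<le> r * (norm a + norm b + 1)"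
        using r by (simp add: algebra_simps)
      also have "\<dots> = d / 2"
        using nn by (simp add: r_def field_simps)
      finally show ?thesis using d by linarith
    qed
    have sub: "z + s *\<^sub>R a + t *\<^sub>R b \<in> S" if "s \<in> {0..r}" "t \<in> {0..r}" for s t
      using near[OF that] d3 by (auto simp: d_def dist_commute)
    obtain s t where st: "s \<in> {0..r}" "t \<in> {0..r}"
      "F (z + r *\<^sub>R a + r *\<^sub>R b) - F (z + r *\<^sub>R a) - F (z + r *\<^sub>R b) + F z =
       r * r * H a b (z + s *\<^sub>R a + t *\<^sub>R b)"
      using second_difference_mean_value[OF F S r, of z a b] sub unfolding H_def by blast
    have sub': "z + s *\<^sub>R b + t *\<^sub>R a \<in> S" if "s \<in> {0..r}" "t \<in> {0..r}" for s t
      using sub[OF that(2,1)] by (simp add: algebra_simps)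
    obtain s' t' where st': "s' \<in> {0..r}" "t' \<in> {0..r}"
      "F (z + r *\<^sub>R b + r *\<^sub>R a) - F (z + r *\<^sub>R b) - F (z + r *\<^sub>R a) + F z =
       r * r * H b a (z + s' *\<^sub>R b + t' *\<^sub>R a)"
      using second_difference_mean_value[OF F S r, of z b a] sub' unfolding H_def by blast
    have "r * r * H a b (z + s *\<^sub>R a + t *\<^sub>R b) = r * r * H b a (z + t' *\<^sub>R a + s' *\<^sub>R b)"
      using st(3) st'(3) by (simp add: algebra_simps)
    then have "H a b (z + s *\<^sub>R a + t *\<^sub>R b) = H b a (z + t' *\<^sub>R a + s' *\<^sub>R b)"
      using r by simp
    moreover have "dist (H a b (z + s *\<^sub>R a + t *\<^sub>R b)) (H a b z) < e"
      by (rule d1(2)) (use near[OF st(1,2)] in \<open>simp add: d_def\<close>)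
    moreover have "dist (H b a (z + t' *\<^sub>R a + s' *\<^sub>R b)) (H b a z) < e"
      by (rule d2(2)) (use near[OF st'(2,1)] in \<open>simp add: d_def\<close>)
    ultimately show ?thesis by (simp add: dist_real_def)
  qed
  from this[of "\<bar>H a b z - H b a z\<bar> / 2"] have "H a b z = H b a z"
    by (cases "H a b z = H b a z") auto
  then show ?thesis by (simp add: H_def)
qed


section \<open>Smooth maps into a Lie group\<close>

text \<open>Smoothness of a map from a Euclidean space, of any dimension, into the manifold. With
  one-dimensional domain this is \<open>smooth_curve\<close>; chart inverses and the group multiplication read
  in two charts are covered as well, so that smoothness of formulas built from them follows by
  composition.\<close>

definition smooth_into ::
  "'g::topological_space chart set \<Rightarrow> 'a::euclidean_space set \<Rightarrow> ('a \<Rightarrow> 'g) \<Rightarrow> bool" where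
  "smooth_into A S m \<longleftrightarrow> continuous_on S m \<and>
     (\<forall>(U, \<phi>)\<in>A. smooth_on {x\<in>S. m x \<in> U} (\<phi> \<circ> m))"

lemma smooth_intoI:
  assumes "continuous_on S m" "\<And>U \<phi>. (U, \<phi>) \<in> A \<Longrightarrow> smooth_on {x\<in>S. m x \<in> U} (\<phi> \<circ> m)"
  shows "smooth_into A S m"
  using assms unfolding smooth_into_def by blast

lemma smooth_curve_iff_smooth_into: "smooth_curve A I c \<longleftrightarrow> smooth_into A I c"
  unfolding smooth_curve_def smooth_into_def ..

lemma smooth_into_subset: "smooth_into A S m \<Longrightarrow> T \<subseteq> S \<Longrightarrow> smooth_into A T m"
proof (rule smooth_intoI)
  assume m: "smooth_into A S m" and T: "T \<subseteq> S"
  show "continuous_on T m"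
    using m T continuous_on_subset unfolding smooth_into_def by blast
  fix U \<phi> assume "(U, \<phi>) \<in> A"
  then have "smooth_on {x\<in>S. m x \<in> U} (\<phi> \<circ> m)"
    using m unfolding smooth_into_def by blast
  then show "smooth_on {x\<in>T. m x \<in> U} (\<phi> \<circ> m)"
    by (rule smooth_on_subset) (use T in blast)
qed

lemma smooth_into_const: "smooth_into A S (\<lambda>x. p)"
  by (rule smooth_intoI) (simp_all add: o_def smooth_on_const)

lemma smooth_into_compose:
  assumes m: "smooth_into A T m" and f: "smooth_on S f" and sub: "f ` S \<subseteq> T"
  shows "smooth_into A S (\<lambda>x. m (f x))"
proof (rule smooth_intoI)
  show "continuous_on S (\<lambda>x. m (f x))"
    using m sub smooth_on_continuous[OF f] unfolding smooth_into_def
    by (auto intro: continuous_on_compose2)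
next
  fix U \<phi> assume "(U, \<phi>) \<in> A"
  then have "smooth_on {x\<in>T. m x \<in> U} (\<phi> \<circ> m)"
    using m unfolding smooth_into_def by auto
  then have "smooth_on {x\<in>S. m (f x) \<in> U} (\<lambda>x. (\<phi> \<circ> m) (f x))"
    by (rule smooth_on_compose[OF _ smooth_on_subset[OF f]]) (use sub in auto)
  then show "smooth_on {x\<in>S. m (f x) \<in> U} (\<phi> \<circ> (\<lambda>x. m (f x)))"
    by (simp add: o_def)
qed

lemma smooth_into_preimage_open:
  "smooth_into A S m \<Longrightarrow> open S \<Longrightarrow> open U \<Longrightarrow> open {x\<in>S. m x \<in> U}"
  unfolding smooth_into_def
  using continuous_open_preimage[of S m U] by (simp add: Int_def vimage_def)

locale lie_group_atlas =
  fixes A :: "'g::{topological_group_add, t2_space, second_countable_topology} chart set"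
  assumes lie_group: "lie_group A"
begin

lemma atlas: "smooth_atlas A"
  using lie_group unfolding lie_group_def by blast

lemma chart_at: "\<exists>U \<phi>. (U, \<phi>) \<in> A \<and> p \<in> U"
  using atlas unfolding smooth_atlas_def by blast

lemma chart:
  assumes "(U, \<phi>) \<in> A"
  shows chart_open: "open U" and chart_image_open: "open (\<phi> ` U)"
    and chart_homeomorphism: "homeomorphism U (\<phi> ` U) \<phi> (inv_into U \<phi>)"
  using atlas assms unfolding smooth_atlas_def by auto

lemma chart_inverse:
  assumes "(U, \<phi>) \<in> A"
  shows "x \<in> U \<Longrightarrow> inv_into U \<phi> (\<phi> x) = x"
    and "y \<in> \<phi> ` U \<Longrightarrow> \<phi> (inv_into U \<phi> y) = y"
    and "y \<in> \<phi> ` U \<Longrightarrow> inv_into U \<phi> y \<in> U"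
  using chart_homeomorphism[OF assms]
  by (simp_all add: homeomorphism_def f_inv_into_f inv_into_into)

lemma chart_image_Int:
  assumes "(U, \<phi>) \<in> A"
  shows "{y \<in> \<phi> ` U. inv_into U \<phi> y \<in> P} = \<phi> ` (U \<inter> P)"
proof (intro equalityI subsetI)
  fix y assume "y \<in> {y \<in> \<phi> ` U. inv_into U \<phi> y \<in> P}"
  then have "inv_into U \<phi> y \<in> U \<inter> P" "y = \<phi> (inv_into U \<phi> y)"
    using chart_inverse(2,3)[OF assms, of y] by auto
  then show "y \<in> \<phi> ` (U \<inter> P)" by blast
next
  fix y assume "y \<in> \<phi> ` (U \<inter> P)"
  then show "y \<in> {y \<in> \<phi> ` U. inv_into U \<phi> y \<in> P}"
    using chart_inverse(1)[OF assms] by auto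
qed

lemma chart_image_Int_open:
  assumes "(U, \<phi>) \<in> A" "open P"
  shows "open (\<phi> ` (U \<inter> P))"
proof -
  have "continuous_on (\<phi> ` U) (inv_into U \<phi>)"
    using chart_homeomorphism[OF assms(1)] by (simp add: homeomorphism_def)
  then have "open (\<phi> ` U \<inter> inv_into U \<phi> -` P)"
    using chart_image_open[OF assms(1)] assms(2) continuous_open_preimage by blast
  moreover have "\<phi> ` U \<inter> inv_into U \<phi> -` P = \<phi> ` (U \<inter> P)"
    using chart_image_Int[OF assms(1), of P] by blast
  ultimately show ?thesis by simp
qed

lemma smooth_into_chart_inverse:
  assumes "(U, \<phi>) \<in> A"
  shows "smooth_into A (\<phi> ` U) (inv_into U \<phi>)"
proof (rule smooth_intoI)
  show "continuous_on (\<phi> ` U) (inv_into U \<phi>)"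
    using chart_homeomorphism[OF assms] by (simp add: homeomorphism_def)
next
  fix V \<psi> assume "(V, \<psi>) \<in> A"
  then show "smooth_on {x \<in> \<phi> ` U. inv_into U \<phi> x \<in> V} (\<psi> \<circ> inv_into U \<phi>)"
    using atlas assms unfolding smooth_atlas_def chart_image_Int[OF assms] by fast
qed

text \<open>Near a given point both factors stay in one chart each, and there the product is the coordinate
  expression of the multiplication composed with the pair of coordinate maps.\<close>

lemma smooth_into_add:
  assumes m: "smooth_into A S m" and n: "smooth_into A S n" and S: "open S"
  shows "smooth_into A S (\<lambda>x. m x + n x)"
proof (rule smooth_intoI)
  show cont: "continuous_on S (\<lambda>x. m x + n x)"
    using m n unfolding smooth_into_def by (intro continuous_on_add) auto
  fix W \<theta> assume W: "(W, \<theta>) \<in> A"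
  let ?S = "{x\<in>S. m x + n x \<in> W}"
  have "open ?S"
    using continuous_open_preimage[OF cont S chart_open[OF W]] by (simp add: Int_def vimage_def)
  then show "smooth_on ?S (\<theta> \<circ> (\<lambda>x. m x + n x))"
  proof (rule smooth_on_local)
    fix x assume "x \<in> ?S"
    obtain U \<phi> V \<psi> where U: "(U, \<phi>) \<in> A" "m x \<in> U" and V: "(V, \<psi>) \<in> A" "n x \<in> V"
      using chart_at by metis
    let ?N = "{x\<in>S. m x \<in> U} \<inter> {x\<in>S. n x \<in> V}"
    let ?G = "\<lambda>(x, y). \<theta> (inv_into U \<phi> x + inv_into V \<psi> y)"
    have G: "smooth_on {(x, y). x \<in> \<phi> ` U \<and> y \<in> \<psi> ` V \<and> inv_into U \<phi> x + inv_into V \<psi> y \<in> W} ?G"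
      using lie_group U(1) V(1) W unfolding lie_group_def by fast
    have "smooth_on {x\<in>S. m x \<in> U} (\<phi> \<circ> m)" "smooth_on {x\<in>S. n x \<in> V} (\<psi> \<circ> n)"
      using m n U V unfolding smooth_into_def by fast+
    then have "smooth_on (?S \<inter> ?N) (\<phi> \<circ> m)" "smooth_on (?S \<inter> ?N) (\<psi> \<circ> n)"
      by (auto elim: smooth_on_subset)
    then have "smooth_on (?S \<inter> ?N) (\<lambda>x. ((\<phi> \<circ> m) x, (\<psi> \<circ> n) x))"
      by (rule smooth_on_Pair)
    then have "smooth_on (?S \<inter> ?N) (\<lambda>x. ?G ((\<phi> \<circ> m) x, (\<psi> \<circ> n) x))"
      by (rule smooth_on_compose[OF G])
         (auto simp: chart_inverse[OF U(1)] chart_inverse[OF V(1)])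
    then have "smooth_on (?S \<inter> ?N) (\<theta> \<circ> (\<lambda>x. m x + n x))"
      by (subst (asm) smooth_on_cong[where g = "\<theta> \<circ> (\<lambda>x. m x + n x)"])
         (auto simp: chart_inverse[OF U(1)] chart_inverse[OF V(1)])
    moreover have "open ?N"
      by (intro open_Int smooth_into_preimage_open[OF m S] smooth_into_preimage_open[OF n S]
          chart_open[OF U(1)] chart_open[OF V(1)])
    moreover have "x \<in> ?N" using \<open>x \<in> ?S\<close> U V by simp
    ultimately show "\<exists>N. open N \<and> x \<in> N \<and> smooth_on (?S \<inter> N) (\<theta> \<circ> (\<lambda>x. m x + n x))"
      by blast
  qed
qed

lemma smooth_fun_compose:
  assumes f: "smooth_fun A P f" and m: "smooth_into A S m" and S: "open S" and sub: "m ` S \<subseteq> P"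
  shows "smooth_on S (\<lambda>x. f (m x))"
  using S
proof (rule smooth_on_local)
  fix x assume x: "x \<in> S"
  obtain U \<phi> where U: "(U, \<phi>) \<in> A" "m x \<in> U"
    using chart_at by metis
  let ?N = "{x\<in>S. m x \<in> U}"
  have "smooth_on (\<phi> ` (U \<inter> P)) (f \<circ> inv_into U \<phi>)" "smooth_on ?N (\<phi> \<circ> m)"
    using f m U unfolding smooth_fun_def smooth_into_def by fast+
  then have "smooth_on ?N (\<lambda>x. (f \<circ> inv_into U \<phi>) ((\<phi> \<circ> m) x))"
    by (rule smooth_on_compose) (use sub in auto)
  then have "smooth_on ?N (\<lambda>x. f (m x))"
    by (subst (asm) smooth_on_cong[where g = "\<lambda>x. f (m x)"]) (auto simp: chart_inverse[OF U(1)])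
  moreover have "S \<inter> ?N = ?N" by blast
  ultimately have "smooth_on (S \<inter> ?N) (\<lambda>x. f (m x))" by simp
  then show "\<exists>N. open N \<and> x \<in> N \<and> smooth_on (S \<inter> N) (\<lambda>x. f (m x))"
    using smooth_into_preimage_open[OF m S chart_open[OF U(1)]] x U(2) by blast
qed

lemma smooth_fun_const: "smooth_fun A UNIV (\<lambda>p. c)"
  unfolding smooth_fun_def o_def using smooth_on_const by blast

lemma smooth_funI:
  assumes "open P" "\<And>U \<phi>. (U, \<phi>) \<in> A \<Longrightarrow> smooth_on (\<phi> ` (U \<inter> P)) (\<lambda>x. f (inv_into U \<phi> x))"
  shows "smooth_fun A P f"
  using assms unfolding smooth_fun_def o_def by blast

lemma smooth_funD:
  assumes "smooth_fun A P f"
  shows "open P" "(U, \<phi>) \<in> A \<Longrightarrow> smooth_on (\<phi> ` (U \<inter> P)) (\<lambda>x. f (inv_into U \<phi> x))"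
  using assms unfolding smooth_fun_def o_def by blast+

lemma smooth_fun_subset:
  assumes "smooth_fun A P f" "open Q" "Q \<subseteq> P"
  shows "smooth_fun A Q f"
proof (rule smooth_funI[OF assms(2)])
  fix U \<phi> assume "(U, \<phi>) \<in> A"
  from smooth_funD(2)[OF assms(1) this]
  show "smooth_on (\<phi> ` (U \<inter> Q)) (\<lambda>x. f (inv_into U \<phi> x))"
    by (rule smooth_on_subset) (use assms(3) in blast)
qed

lemma smooth_fun_add:
  assumes "smooth_fun A P f" "smooth_fun A P g"
  shows "smooth_fun A P (\<lambda>p. f p + g p)"
  by (rule smooth_funI[OF smooth_funD(1)[OF assms(1)]],
      rule smooth_on_add[OF smooth_funD(2)[OF assms(1)] smooth_funD(2)[OF assms(2)]])

lemma smooth_fun_mult: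
  assumes "smooth_fun A P f" "smooth_fun A P g"
  shows "smooth_fun A P (\<lambda>p. f p * g p)"
  by (rule smooth_funI[OF smooth_funD(1)[OF assms(1)]],
      rule smooth_on_mult[OF smooth_funD(2)[OF assms(1)] smooth_funD(2)[OF assms(2)]])

text \<open>Left and right translations are the case \<open>b = 0\<close> and the case \<open>a = 0\<close>.\<close>

lemma smooth_into_translate:
  "smooth_into A S m \<Longrightarrow> open S \<Longrightarrow> smooth_into A S (\<lambda>x. a + m x + b)"
  using smooth_into_add[OF smooth_into_add[OF smooth_into_const]] smooth_into_const by blast

lemma smooth_fun_translate:
  assumes f: "smooth_fun A P f"
  shows "smooth_fun A {z. a + z + b \<in> P} (\<lambda>z. f (a + z + b))"
proof -
  have "open ((\<lambda>z. a + z + b) -` P)"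
    using f unfolding smooth_fun_def
    by (intro open_vimage continuous_on_add continuous_on_const continuous_on_id) auto
  then have Q: "open {z. a + z + b \<in> P}" by (simp add: vimage_def)
  have "smooth_on (\<phi> ` (U \<inter> {z. a + z + b \<in> P})) (\<lambda>x. f (a + inv_into U \<phi> x + b))"
    if U: "(U, \<phi>) \<in> A" for U \<phi>
  proof (rule smooth_fun_compose[OF f])
    show "open (\<phi> ` (U \<inter> {z. a + z + b \<in> P}))"
      by (rule chart_image_Int_open[OF U Q])
    then show "smooth_into A (\<phi> ` (U \<inter> {z. a + z + b \<in> P})) (\<lambda>x. a + inv_into U \<phi> x + b)"
      by (intro smooth_into_translate smooth_into_subset[OF smooth_into_chart_inverse[OF U]]) auto
    show "(\<lambda>x. a + inv_into U \<phi> x + b) ` \<phi> ` (U \<inter> {z. a + z + b \<in> P}) \<subseteq> P"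
      using chart_inverse[OF U] by auto
  qed
  with Q show ?thesis unfolding smooth_fun_def o_def by auto
qed

lemma smooth_near_translate:
  "smooth_near A (a + p + b) f \<Longrightarrow> smooth_near A p (\<lambda>z. f (a + z + b))"
  unfolding smooth_near_def
proof (elim exE conjE)
  fix P assume "a + p + b \<in> P" "smooth_fun A P f"
  then show "\<exists>Q. p \<in> Q \<and> smooth_fun A Q (\<lambda>z. f (a + z + b))"
    by (intro exI[of _ "{z. a + z + b \<in> P}"]) (simp add: smooth_fun_translate)
qed


section \<open>Tangent vectors in a chart\<close>

text \<open>A tangent vector given by its coordinates in a chart. The value \<open>0\<close> on other functions follows the
  convention for velocities.\<close>

definition chart_vector :: "'g set \<Rightarrow> ('g \<Rightarrow> real^3) \<Rightarrow> 'g \<Rightarrow> real^3 \<Rightarrow> 'g tangent" where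
  "chart_vector U \<phi> p w =
     (\<lambda>f. if smooth_near A p f then frechet_derivative (f \<circ> inv_into U \<phi>) (at (\<phi> p)) w else 0)"

lemma smooth_near_differentiable:
  assumes U: "(U, \<phi>) \<in> A" "p \<in> U" and f: "smooth_near A p f"
  shows "(f \<circ> inv_into U \<phi>) differentiable (at (\<phi> p))"
proof -
  obtain P where P: "p \<in> P" "smooth_fun A P f"
    using f unfolding smooth_near_def by blast
  then have "smooth_on (\<phi> ` (U \<inter> P)) (f \<circ> inv_into U \<phi>)" "open P"
    using U unfolding smooth_fun_def by auto
  then show ?thesis
    using smooth_on_differentiable[OF _ chart_image_Int_open[OF U(1)]] P(1) U(2) by blast
qed

text \<open>By the chain rule for \<open>f \<circ> c = (f \<circ> \<phi>\<inverse>) \<circ> (\<phi> \<circ> c)\<close>. The set \<open>N\<close> is a neighbourhood of \<open>t\<close> on which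
  the curve stays in the chart.\<close>

lemma velocity_eq_chart_vector:
  assumes U: "(U, \<phi>) \<in> A" "c t \<in> U" and J: "open J" "t \<in> J"
    and N: "open N" "t \<in> N" "\<And>s. s \<in> N \<Longrightarrow> c s \<in> U"
    and w: "((\<lambda>s. \<phi> (c s)) has_vector_derivative w) (at t)"
  shows "velocity A J c t = chart_vector U \<phi> (c t) w"
proof
  fix f
  show "velocity A J c t f = chart_vector U \<phi> (c t) w f"
  proof (cases "smooth_near A (c t) f")
    case True
    let ?g = "f \<circ> inv_into U \<phi>"
    have "(?g has_derivative frechet_derivative ?g (at (\<phi> (c t)))) (at (\<phi> (c t)))"
      using smooth_near_differentiable[OF U True] by (simp add: frechet_derivative_works)
    then have "((\<lambda>s. ?g (\<phi> (c s))) has_derivative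
        (\<lambda>h. frechet_derivative ?g (at (\<phi> (c t))) (h *\<^sub>R w))) (at t)"
      using w has_derivative_compose[of "\<lambda>s. \<phi> (c s)" "\<lambda>h. h *\<^sub>R w" t UNIV ?g]
      unfolding has_vector_derivative_def by blast
    then have "((f \<circ> c) has_derivative
        (\<lambda>h. frechet_derivative ?g (at (\<phi> (c t))) (h *\<^sub>R w))) (at t)"
      by (rule has_derivative_transform_within_open[OF _ N(1,2)])
         (simp add: chart_inverse[OF U(1)] N(3))
    moreover have "linear (frechet_derivative ?g (at (\<phi> (c t))))"
      using smooth_near_differentiable[OF U True] by (rule linear_frechet_derivative)
    ultimately have "((f \<circ> c) has_vector_derivative frechet_derivative ?g (at (\<phi> (c t))) w) (at t)"
      unfolding has_vector_derivative_def by (simp add: linear_scale)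
    then have "vector_derivative (f \<circ> c) (at t within J) = frechet_derivative ?g (at (\<phi> (c t))) w"
      unfolding at_within_open[OF J(2,1)] by (rule vector_derivative_at)
    with True show ?thesis by (simp add: velocity_def chart_vector_def)
  qed (simp add: velocity_def chart_vector_def)
qed

text \<open>Velocities of curves do not obviously form a vector space. They do because every coordinate
  vector \<open>w\<close> is realised, by the curve that is the straight line in direction \<open>w\<close> in the chart.\<close>

lemma tangent_space_eq_chart_vectors:
  assumes U: "(U, \<phi>) \<in> A" "p \<in> U"
  shows "tangent_space A p = range (chart_vector U \<phi> p)"
proof (intro equalityI subsetI)
  fix v assume "v \<in> tangent_space A p"
  then obtain e c where e: "e > 0" and c: "smooth_into A {-e<..<e} c" "c 0 = p"
    and v: "v = velocity A {-e<..<e} c 0"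
    unfolding tangent_space_def smooth_curve_iff_smooth_into by blast
  let ?N = "{s \<in> {-e<..<e}. c s \<in> U}"
  have N: "open ?N" "0 \<in> ?N"
    using smooth_into_preimage_open[OF c(1) _ chart_open[OF U(1)]] e c U(2) by auto
  have "smooth_on ?N (\<phi> \<circ> c)"
    using c(1) U(1) unfolding smooth_into_def by fast
  then have "(\<lambda>s. \<phi> (c s)) differentiable (at 0)"
    using smooth_on_differentiable[OF _ N] unfolding o_def by blast
  then have "((\<lambda>s. \<phi> (c s)) has_vector_derivative vector_derivative (\<lambda>s. \<phi> (c s)) (at 0)) (at 0)"
    by (simp add: vector_derivative_works)
  from velocity_eq_chart_vector[OF U(1) _ _ _ N _ this, of "{-e<..<e}"]
  show "v \<in> range (chart_vector U \<phi> p)"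
    using c(2) U(2) e v by auto
next
  fix v assume "v \<in> range (chart_vector U \<phi> p)"
  then obtain w where v: "v = chart_vector U \<phi> p w" by blast
  let ?l = "\<lambda>s::real. \<phi> p + s *\<^sub>R w"
  have l: "smooth_on UNIV ?l"
    by (rule smooth_on_add[OF smooth_on_const smooth_on_linear[OF bounded_linear_scaleR_left]])
  have "open (?l -` (\<phi> ` U))"
    by (intro open_vimage chart_image_open[OF U(1)] smooth_on_continuous[OF l])
  moreover have "0 \<in> ?l -` (\<phi> ` U)" using U(2) by simp
  ultimately obtain e where e: "e > 0" "ball 0 e \<subseteq> ?l -` (\<phi> ` U)"
    using open_contains_ball by blast
  let ?c = "\<lambda>s. inv_into U \<phi> (?l s)"
  have sub: "?l s \<in> \<phi> ` U" if "s \<in> {-e<..<e}" for s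
    using e that by (auto simp: subset_iff)
  have "smooth_into A {-e<..<e} ?c"
    by (rule smooth_into_compose[OF smooth_into_chart_inverse[OF U(1)] smooth_on_subset[OF l]])
       (use sub in auto)
  moreover have c0: "?c 0 = p" using chart_inverse[OF U(1)] U(2) by simp
  moreover have "velocity A {-e<..<e} ?c 0 = chart_vector U \<phi> (?c 0) w"
  proof (rule velocity_eq_chart_vector[OF U(1), of _ _ _ "{-e<..<e}"])
    have "(?l has_vector_derivative w) (at 0)"
      by (auto simp: has_vector_derivative_def intro!: derivative_eq_intros)
    then show "((\<lambda>s. \<phi> (?c s)) has_vector_derivative w) (at 0)"
      by (rule has_vector_derivative_transform_within_open[of _ _ _ "{-e<..<e}"])
         (use e chart_inverse[OF U(1)] sub in auto)
  qed (use e c0 U chart_inverse[OF U(1)] sub in auto)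
  ultimately show "v \<in> tangent_space A p"
    unfolding tangent_space_def smooth_curve_iff_smooth_into v using e(1) by force
qed

lemma chart_vector_linear_combination:
  assumes U: "(U, \<phi>) \<in> A" "p \<in> U"
  shows "(\<lambda>f. a * chart_vector U \<phi> p v f + b * chart_vector U \<phi> p w f) =
    chart_vector U \<phi> p (a *\<^sub>R v + b *\<^sub>R w)"
proof
  fix f
  have "linear (frechet_derivative (f \<circ> inv_into U \<phi>) (at (\<phi> p)))" if "smooth_near A p f"
    using smooth_near_differentiable[OF U that] by (rule linear_frechet_derivative)
  then show "a * chart_vector U \<phi> p v f + b * chart_vector U \<phi> p w f =
      chart_vector U \<phi> p (a *\<^sub>R v + b *\<^sub>R w) f"
    by (simp add: chart_vector_def linear_add linear_scale)
qed

lemma tangent_space_linear_combination: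
  assumes "u \<in> tangent_space A p" "v \<in> tangent_space A p"
  shows "(\<lambda>f. a * u f + b * v f) \<in> tangent_space A p"
proof -
  obtain U \<phi> where U: "(U, \<phi>) \<in> A" "p \<in> U"
    using chart_at by metis
  show ?thesis
    using assms chart_vector_linear_combination[OF U]
    unfolding tangent_space_eq_chart_vectors[OF U] by auto
qed

lemma tangent_space_zero: "(\<lambda>f. 0) \<in> tangent_space A p"
proof -
  obtain U \<phi> where U: "(U, \<phi>) \<in> A" "p \<in> U"
    using chart_at by metis
  then have "chart_vector U \<phi> p 0 \<in> tangent_space A p"
    unfolding tangent_space_eq_chart_vectors[OF U] by blast
  from tangent_space_linear_combination[OF this this, of 0 0] show ?thesis by simp
qed

lemma tangent_space_sum:
  "(\<And>i. i \<in> J \<Longrightarrow> v i \<in> tangent_space A p) \<Longrightarrow>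
    (\<lambda>f. \<Sum>i\<in>J. u i * v i f) \<in> tangent_space A p"
proof (induction J rule: infinite_finite_induct)
  case (insert i J)
  then show ?case
    using tangent_space_linear_combination[of "v i" p "\<lambda>f. \<Sum>i\<in>J. u i * v i f" "u i" 1] by simp
qed (simp_all add: tangent_space_zero)

lemma tangent_vector_not_smooth:
  "v \<in> tangent_space A p \<Longrightarrow> \<not> smooth_near A p f \<Longrightarrow> v f = 0"
  unfolding tangent_space_def velocity_def by auto

lemma tangent_vector_const:
  assumes "v \<in> tangent_space A p"
  shows "v (\<lambda>q. c) = 0"
proof -
  obtain e d where e: "e > 0" and v: "v = velocity A {-e<..<e} d 0"
    using assms unfolding tangent_space_def by blast
  have "((\<lambda>s::real. c) has_vector_derivative 0) (at 0 within {-e<..<e})"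
    by simp
  then have "vector_derivative (\<lambda>s::real. c) (at 0 within {-e<..<e}) = 0"
    using e at_within_open[of 0 "{-e<..<e}"] by (auto intro: vector_derivative_at)
  then show ?thesis unfolding v velocity_def by (simp add: o_def)
qed

lemma pushforward_tangent:
  assumes "v \<in> tangent_space A p"
  shows "pushforward A (\<lambda>z. a + z + b) p v \<in> tangent_space A (a + p + b)"
proof -
  obtain e c where e: "e > 0" and c: "smooth_into A {-e<..<e} c" "c 0 = p"
    and v: "v = velocity A {-e<..<e} c 0"
    using assms unfolding tangent_space_def smooth_curve_iff_smooth_into by blast
  have "pushforward A (\<lambda>z. a + z + b) p v = velocity A {-e<..<e} (\<lambda>s. a + c s + b) 0"
    using smooth_near_translate[of a p b] c(2)
    by (auto simp: pushforward_def velocity_def v fun_eq_iff o_def)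
  moreover have "smooth_into A {-e<..<e} (\<lambda>s. a + c s + b)"
    by (intro smooth_into_translate c) auto
  ultimately show ?thesis
    unfolding tangent_space_def smooth_curve_iff_smooth_into using e c(2) by auto
qed


section \<open>Left-invariant and right-invariant vector fields\<close>

lemma smooth_vfieldD:
  assumes "smooth_vfield A X"
  shows "X p \<in> tangent_space A p" and "smooth_fun A P f \<Longrightarrow> smooth_fun A P (\<lambda>q. X q f)"
  using assms unfolding smooth_vfield_def by blast+

lemma lie_algebraD:
  assumes "X \<in> lie_algebra A"
  shows "smooth_vfield A X" and "X (a + p) = pushforward A (\<lambda>q. a + q) p (X p)"
  using assms unfolding lie_algebra_def by blast+

lemma smooth_vfield_combination:
  assumes X: "smooth_vfield A X" and Y: "smooth_vfield A Y"
    and f: "smooth_fun A UNIV f" and g: "smooth_fun A UNIV g"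
  shows "smooth_vfield A (\<lambda>p \<xi>. f p * X p \<xi> + g p * Y p \<xi>)"
  unfolding smooth_vfield_def
proof (intro conjI allI impI)
  show "(\<lambda>\<xi>. f p * X p \<xi> + g p * Y p \<xi>) \<in> tangent_space A p" for p
    by (intro tangent_space_linear_combination smooth_vfieldD(1) X Y)
  fix P k assume k: "smooth_fun A P k"
  have "smooth_fun A P f" "smooth_fun A P g"
    using smooth_fun_subset[OF f] smooth_fun_subset[OF g] smooth_funD(1)[OF k] by auto
  then show "smooth_fun A P (\<lambda>q. f q * X q k + g q * Y q k)"
    by (intro smooth_fun_add[OF smooth_fun_mult smooth_fun_mult] smooth_vfieldD(2)[OF X k]
        smooth_vfieldD(2)[OF Y k])
qed

lemma smooth_vfield_zero: "smooth_vfield A (\<lambda>p \<xi>. 0)"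
  unfolding smooth_vfield_def
  using tangent_space_zero smooth_fun_subset[OF smooth_fun_const] smooth_funD(1) by blast

lemma smooth_vfield_sum:
  assumes "\<And>i. i \<in> J \<Longrightarrow> smooth_fun A UNIV (f i)" "\<And>i. i \<in> J \<Longrightarrow> smooth_vfield A (X i)"
  shows "smooth_vfield A (\<lambda>p \<xi>. \<Sum>i\<in>J. f i p * X i p \<xi>)"
  using assms
proof (induction J rule: infinite_finite_induct)
  case (insert i J)
  then show ?case
    using smooth_vfield_combination[of "X i" "\<lambda>p \<xi>. \<Sum>i\<in>J. f i p * X i p \<xi>" "f i" "\<lambda>_. 1"]
      smooth_fun_const by simp
qed (simp_all add: smooth_vfield_zero)

text \<open>The right-invariant field with value \<open>v\<close> at \<open>p\<close>, not at the identity: translation by \<open>- p + q\<close> on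
  the right takes \<open>p\<close> to \<open>q\<close>.\<close>

definition right_invariant :: "'g \<Rightarrow> 'g tangent \<Rightarrow> 'g vfield" where
  "right_invariant p v q = pushforward A (\<lambda>z. z + (- p + q)) p v"

lemma right_invariant_tangent:
  assumes "v \<in> tangent_space A p"
  shows "right_invariant p v q \<in> tangent_space A q"
  using pushforward_tangent[OF assms, of 0 "- p + q"] unfolding right_invariant_def by simp

lemma right_invariant_base:
  assumes "v \<in> tangent_space A p"
  shows "right_invariant p v p = v"
  using tangent_vector_not_smooth[OF assms]
  by (auto simp: right_invariant_def pushforward_def fun_eq_iff o_def)

text \<open>For \<open>b = - p\<close> the map \<open>(x, y) \<mapsto> f (x - p + y)\<close> generates both kinds of invariant fields:
  differentiating it in \<open>x\<close> at \<open>p\<close> gives the right-invariant derivative of \<open>f\<close> at \<open>y\<close>, differentiating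
  it in \<open>y\<close> at \<open>p\<close> gives the left-invariant derivative of \<open>f\<close> at \<open>x\<close>. The following lemmas read this
  off in charts.\<close>

lemma smooth_two_points:
  fixes b
  assumes U: "(U, \<phi>) \<in> A" and V: "(V, \<psi>) \<in> A" and f: "smooth_fun A P f"
  defines "m \<equiv> \<lambda>z. inv_into U \<phi> (fst z) + (b + inv_into V \<psi> (snd z))"
  defines "S \<equiv> {z \<in> \<phi> ` U \<times> \<psi> ` V. m z \<in> P}"
  shows "open S" and "smooth_on S (\<lambda>z. f (m z))"
proof -
  have fst: "smooth_on (\<phi> ` U \<times> \<psi> ` V) fst" and snd: "smooth_on (\<phi> ` U \<times> \<psi> ` V) snd"
    by (intro smooth_on_linear bounded_linear_fst bounded_linear_snd)+
  have O: "open (\<phi> ` U \<times> \<psi> ` V)"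
    by (intro open_Times chart_image_open[OF U] chart_image_open[OF V])
  have m: "smooth_into A (\<phi> ` U \<times> \<psi> ` V) m"
    unfolding m_def
    by (intro smooth_into_add smooth_into_const O
        smooth_into_compose[OF smooth_into_chart_inverse[OF U] fst]
        smooth_into_compose[OF smooth_into_chart_inverse[OF V] snd]) auto
  show S: "open S"
    unfolding S_def by (rule smooth_into_preimage_open[OF m O smooth_funD(1)[OF f]])
  show "smooth_on S (\<lambda>z. f (m z))"
    by (rule smooth_fun_compose[OF f smooth_into_subset[OF m] S]) (auto simp: S_def)
qed

lemma right_invariant_in_chart:
  assumes U: "(U, \<phi>) \<in> A" "p \<in> U" and V: "(V, \<psi>) \<in> A" "y \<in> \<psi> ` V"
    and f: "smooth_fun A P f" "inv_into V \<psi> y \<in> P"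
  shows "right_invariant p (chart_vector U \<phi> p w) (inv_into V \<psi> y) f =
    frechet_derivative (\<lambda>z. f (inv_into U \<phi> (fst z) + (- p + inv_into V \<psi> (snd z)))) (at (\<phi> p, y)) (w, 0)"
    (is "_ = frechet_derivative ?F _ _")
proof -
  let ?q = "inv_into V \<psi> y"
  have q: "smooth_near A ?q f"
    using f unfolding smooth_near_def by blast
  then have "smooth_near A p (\<lambda>z. f (z + (- p + ?q)))"
    using smooth_near_translate[of 0 p "- p + ?q" f] by simp
  with q have "right_invariant p (chart_vector U \<phi> p w) ?q f =
      frechet_derivative (\<lambda>x. ?F (x, y)) (at (\<phi> p)) w"
    by (simp add: right_invariant_def pushforward_def chart_vector_def o_def)
  also have "\<dots> = frechet_derivative ?F (at (\<phi> p, y)) (w, 0)"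
  proof (rule frechet_derivative_fst)
    show "?F differentiable (at (\<phi> p, y))"
      by (rule smooth_on_differentiable[OF smooth_two_points(2,1)[OF U(1) V(1) f(1), where b = "- p"]])
         (use U V f(2) chart_inverse[OF U(1)] in auto)
  qed
  finally show ?thesis .
qed

lemma smooth_on_frechet_derivative_slice:
  assumes F: "smooth_on S F" and S: "open S"
  shows "smooth_on {y. (x, y) \<in> S} (\<lambda>y. frechet_derivative F (at (x, y)) v)"
proof -
  have "smooth_on {y. (x, y) \<in> S} (\<lambda>y. (x, y))"
    by (intro smooth_on_Pair smooth_on_const smooth_on_linear bounded_linear_ident)
  then show ?thesis
    by (rule smooth_on_compose[OF smooth_on_frechet_derivative[OF F S]]) auto
qed

lemma right_invariant_smooth:
  assumes v: "v \<in> tangent_space A p"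
  shows "smooth_vfield A (right_invariant p v)"
  unfolding smooth_vfield_def
proof (intro conjI allI impI)
  show "right_invariant p v q \<in> tangent_space A q" for q
    by (rule right_invariant_tangent[OF v])
  fix P f assume f: "smooth_fun A P f"
  obtain U \<phi> where U: "(U, \<phi>) \<in> A" "p \<in> U"
    using chart_at by metis
  then obtain w where w: "v = chart_vector U \<phi> p w"
    using v tangent_space_eq_chart_vectors by blast
  show "smooth_fun A P (\<lambda>q. right_invariant p v q f)"
  proof (rule smooth_funI[OF smooth_funD(1)[OF f]])
    fix V \<psi> assume V: "(V, \<psi>) \<in> A"
    note * = smooth_two_points[OF U(1) V f, where b = "- p"]
    have sm: "smooth_on (\<psi> ` (V \<inter> P)) (\<lambda>y. frechet_derivative
        (\<lambda>z. f (inv_into U \<phi> (fst z) + (- p + inv_into V \<psi> (snd z)))) (at (\<phi> p, y)) (w, 0))"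
      by (rule smooth_on_subset[OF smooth_on_frechet_derivative_slice[OF *(2,1)]])
         (use U chart_inverse[OF U(1)] chart_inverse[OF V] in auto)
    have eq: "right_invariant p v (inv_into V \<psi> y) f = frechet_derivative
        (\<lambda>z. f (inv_into U \<phi> (fst z) + (- p + inv_into V \<psi> (snd z)))) (at (\<phi> p, y)) (w, 0)"
      if "y \<in> \<psi> ` (V \<inter> P)" for y
      unfolding w by (rule right_invariant_in_chart[OF U V _ f]) (use that chart_inverse[OF V] in auto)
    show "smooth_on (\<psi> ` (V \<inter> P)) (\<lambda>y. right_invariant p v (inv_into V \<psi> y) f)"
      by (rule iffD2[OF smooth_on_cong[OF eq] sm])
  qed
qed

lemma left_invariant_in_chart:
  assumes X: "X \<in> lie_algebra A" and U: "(U, \<phi>) \<in> A" "p \<in> U" and w: "X p = chart_vector U \<phi> p w"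
    and x: "x \<in> \<phi> ` U" and f: "smooth_fun A P f" "inv_into U \<phi> x \<in> P"
  shows "X (inv_into U \<phi> x) f =
    frechet_derivative (\<lambda>z. f (inv_into U \<phi> (fst z) + (- p + inv_into U \<phi> (snd z)))) (at (x, \<phi> p)) (0, w)"
    (is "_ = frechet_derivative ?F _ _")
proof -
  let ?q = "inv_into U \<phi> x"
  have q: "smooth_near A ?q f"
    using f unfolding smooth_near_def by blast
  then have n: "smooth_near A p (\<lambda>z. f (?q + (- p + z)))"
    using smooth_near_translate[of "?q + - p" p 0 f]
    by (simp add: add.assoc del: add_uminus_conv_diff)
  have "X ?q = X ((?q + - p) + p)"
    by simp
  also have "\<dots> = pushforward A (\<lambda>z. ?q + - p + z) p (X p)"
    by (rule lie_algebraD(2)[OF X])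
  finally have "X ?q f = frechet_derivative (\<lambda>y. ?F (x, y)) (at (\<phi> p)) w"
    using q n by (simp add: pushforward_def chart_vector_def o_def w add.assoc
        del: add_uminus_conv_diff)
  also have "\<dots> = frechet_derivative ?F (at (x, \<phi> p)) (0, w)"
  proof (rule frechet_derivative_snd)
    show "?F differentiable (at (x, \<phi> p))"
      by (rule smooth_on_differentiable[OF smooth_two_points(2,1)[OF U(1) U(1) f(1), where b = "- p"]])
         (use U x f(2) chart_inverse[OF U(1)] in auto)
  qed
  finally show ?thesis .
qed

text \<open>Both orders of differentiation give a mixed second derivative of \<open>f (x - p + y)\<close> at \<open>x = y = p\<close>,
  and these are equal.\<close>

lemma left_right_invariant_commute:
  assumes X: "X \<in> lie_algebra A" and v: "v \<in> tangent_space A p"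
  shows "lie_bracket A X (right_invariant p v) p = (\<lambda>f. 0)"
proof
  fix f
  let ?R = "right_invariant p v"
  show "lie_bracket A X ?R p f = 0"
  proof (cases "smooth_near A p f")
    case True
    then obtain P where P: "p \<in> P" and f: "smooth_fun A P f"
      unfolding smooth_near_def by blast
    obtain U \<phi> where U: "(U, \<phi>) \<in> A" "p \<in> U"
      using chart_at by metis
    obtain w where w: "v = chart_vector U \<phi> p w"
      using v tangent_space_eq_chart_vectors[OF U] by blast
    obtain u where u: "X p = chart_vector U \<phi> p u"
      using smooth_vfieldD(1)[OF lie_algebraD(1)[OF X]] tangent_space_eq_chart_vectors[OF U] by blast
    define F where "F = (\<lambda>z. f (inv_into U \<phi> (fst z) + (- p + inv_into U \<phi> (snd z))))"
    define S where "S = {z \<in> \<phi> ` U \<times> \<phi> ` U. inv_into U \<phi> (fst z) + (- p + inv_into U \<phi> (snd z)) \<in> P}"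
    have S: "open S" and F: "smooth_on S F"
      unfolding S_def F_def by (rule smooth_two_points[OF U(1) U(1) f])+
    have pS: "(\<phi> p, \<phi> p) \<in> S"
      using U P chart_inverse[OF U(1)] by (simp add: S_def)
    have dF: "(\<lambda>z. frechet_derivative F (at z) a) differentiable (at (\<phi> p, \<phi> p))" for a
      by (rule smooth_on_differentiable[OF smooth_on_frechet_derivative[OF F S] S pS])
    let ?N = "\<phi> ` (U \<inter> P)"
    have N: "open ?N" "\<phi> p \<in> ?N"
      using chart_image_Int_open[OF U(1) smooth_funD(1)[OF f]] U(2) P by auto
    have Rf: "?R (inv_into U \<phi> y) f = frechet_derivative F (at (\<phi> p, y)) (w, 0)" if "y \<in> ?N" for y
      unfolding w F_def
      by (rule right_invariant_in_chart[OF U U(1) _ f]) (use that chart_inverse[OF U(1)] in auto)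
    have Xf: "X (inv_into U \<phi> x) f = frechet_derivative F (at (x, \<phi> p)) (0, u)" if "x \<in> ?N" for x
      unfolding F_def
      by (rule left_invariant_in_chart[OF X U u _ f]) (use that chart_inverse[OF U(1)] in auto)
    have sR: "smooth_near A p (\<lambda>q. ?R q f)"
      unfolding smooth_near_def
      using smooth_vfieldD(2)[OF right_invariant_smooth[OF v] f] P by blast
    have sX: "smooth_near A p (\<lambda>q. X q f)"
      unfolding smooth_near_def
      using smooth_vfieldD(2)[OF lie_algebraD(1)[OF X] f] P by blast
    have "X p (\<lambda>q. ?R q f) = frechet_derivative (\<lambda>y. ?R (inv_into U \<phi> y) f) (at (\<phi> p)) u"
      unfolding u using sR by (simp add: chart_vector_def o_def)
    also have "\<dots> = frechet_derivative (\<lambda>y. frechet_derivative F (at (\<phi> p, y)) (w, 0)) (at (\<phi> p)) u"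
      using frechet_derivative_transform_within_open[OF _ N Rf]
        smooth_near_differentiable[OF U sR] by (simp add: o_def)
    also have "\<dots> = frechet_derivative (\<lambda>z. frechet_derivative F (at z) (w, 0)) (at (\<phi> p, \<phi> p)) (0, u)"
      by (rule frechet_derivative_snd[OF dF])
    also have "\<dots> = frechet_derivative (\<lambda>z. frechet_derivative F (at z) (0, u)) (at (\<phi> p, \<phi> p)) (w, 0)"
      by (rule mixed_derivatives_commute[OF F S pS])
    also have "\<dots> = frechet_derivative (\<lambda>x. frechet_derivative F (at (x, \<phi> p)) (0, u)) (at (\<phi> p)) w"
      by (rule frechet_derivative_fst[OF dF, symmetric])
    also have "\<dots> = frechet_derivative (\<lambda>x. X (inv_into U \<phi> x) f) (at (\<phi> p)) w"
      using frechet_derivative_transform_within_open[OF _ N Xf]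
        smooth_near_differentiable[OF U sX] by (simp add: o_def)
    also have "\<dots> = ?R p (\<lambda>q. X q f)"
      unfolding right_invariant_base[OF v] using sX by (simp add: w chart_vector_def o_def)
    finally show ?thesis
      by (simp add: lie_bracket_def)
  qed (simp add: lie_bracket_def)
qed

end


section \<open>Bi-invariant metrics\<close>

locale lie_group_bi_invariant = lie_group_atlas A
  for A :: "'g::{topological_group_add, t2_space, second_countable_topology} chart set" +
  fixes h :: "'g \<Rightarrow> 'g tangent \<Rightarrow> 'g tangent \<Rightarrow> real"
    and nabla :: "'g vfield \<Rightarrow> 'g vfield \<Rightarrow> 'g vfield"
    and E :: "3 \<Rightarrow> 'g vfield"
  assumes bi_invariant: "bi_invariant_metric A h"
    and levi_civita: "levi_civita A h nabla"
    and basis: "orthonormal_basis A h E"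
begin

lemma riemannian: "riemannian_metric A h"
  using bi_invariant unfolding bi_invariant_metric_def by blast

lemma metric_sym:
  "u \<in> tangent_space A p \<Longrightarrow> v \<in> tangent_space A p \<Longrightarrow> h p u v = h p v u"
  using riemannian unfolding riemannian_metric_def by blast

lemma metric_linear_combination:
  "u \<in> tangent_space A p \<Longrightarrow> v \<in> tangent_space A p \<Longrightarrow> w \<in> tangent_space A p \<Longrightarrow>
    h p (\<lambda>f. a * u f + b * v f) w = a * h p u w + b * h p v w"
  using riemannian unfolding riemannian_metric_def by blast

lemma metric_smooth:
  "smooth_vfield A X \<Longrightarrow> smooth_vfield A Y \<Longrightarrow> smooth_fun A UNIV (\<lambda>p. h p (X p) (Y p))"
  using riemannian unfolding riemannian_metric_def by blast

lemma metric_translate: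
  assumes "u \<in> tangent_space A p" "v \<in> tangent_space A p"
  shows "h (a + p) (pushforward A (\<lambda>q. a + q) p u) (pushforward A (\<lambda>q. a + q) p v) = h p u v"
    and "h (p + a) (pushforward A (\<lambda>q. q + a) p u) (pushforward A (\<lambda>q. q + a) p v) = h p u v"
  using bi_invariant assms unfolding bi_invariant_metric_def by blast+

lemma metric_zero: "w \<in> tangent_space A p \<Longrightarrow> h p (\<lambda>f. 0) w = 0"
  using metric_linear_combination[of w p w w 0 0] by simp

lemma metric_sum:
  assumes w: "w \<in> tangent_space A p"
  shows "(\<And>i. i \<in> J \<Longrightarrow> v i \<in> tangent_space A p) \<Longrightarrow>
    h p (\<lambda>f. \<Sum>i\<in>J. c i * v i f) w = (\<Sum>i\<in>J. c i * h p (v i) w)"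
proof (induction J rule: infinite_finite_induct)
  case (insert i J)
  have "h p (\<lambda>f. c i * v i f + 1 * (\<Sum>i\<in>J. c i * v i f)) w =
      c i * h p (v i) w + 1 * h p (\<lambda>f. \<Sum>i\<in>J. c i * v i f) w"
    by (rule metric_linear_combination) (use insert w in \<open>auto intro: tangent_space_sum\<close>)
  then show ?case using insert by simp
qed (simp_all add: metric_zero[OF w])

lemma left_invariant_tangent: "X \<in> lie_algebra A \<Longrightarrow> X p \<in> tangent_space A p"
  using lie_algebraD(1) smooth_vfieldD(1) by blast

lemma left_invariant_inner:
  assumes "X \<in> lie_algebra A" "Y \<in> lie_algebra A"
  shows "h p (X p) (Y p) = alg_inner h X Y"
  using metric_translate(1)[of "X 0" 0 "Y 0" p] assms
    lie_algebraD(2)[of X p 0] lie_algebraD(2)[of Y p 0] left_invariant_tangent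
  by (simp add: alg_inner_def)

lemma right_invariant_inner:
  assumes "u \<in> tangent_space A p" "v \<in> tangent_space A p"
  shows "h q (right_invariant p u q) (right_invariant p v q) = h p u v"
  using metric_translate(2)[OF assms, of "- p + q"] by (simp add: right_invariant_def)

lemma basis_lie_algebra: "E i \<in> lie_algebra A"
  and basis_orthonormal: "h p (E i p) (E j p) = (if i = j then 1 else 0)"
proof -
  show 1: "E i \<in> lie_algebra A" for i
    using basis unfolding orthonormal_basis_def by blast
  show "h p (E i p) (E j p) = (if i = j then 1 else 0)"
    unfolding left_invariant_inner[OF 1 1] using basis unfolding orthonormal_basis_def by blast
qed

lemma basis_tangent: "E i p \<in> tangent_space A p"
  by (rule left_invariant_tangent[OF basis_lie_algebra])

lemma basis_sum_inner: "h p (\<lambda>f. \<Sum>i\<in>UNIV. c i * E i p f) (E j p) = c j"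
  using metric_sum[OF basis_tangent, of UNIV "\<lambda>i. E i p"]
  by (simp add: basis_tangent basis_orthonormal if_distrib cong: if_cong)

text \<open>The tangent space is the image of \<open>real^3\<close> under the chart, and an orthonormal system is linearly
  independent. So the coordinate vectors of the three basis fields form a basis of \<open>real^3\<close>.\<close>

lemma frame_expansion:
  assumes v: "v \<in> tangent_space A p"
  shows "v = (\<lambda>f. \<Sum>i\<in>UNIV. h p v (E i p) * E i p f)"
proof -
  obtain U \<phi> where U: "(U, \<phi>) \<in> A" "p \<in> U"
    using chart_at by metis
  have "\<exists>w. E i p = chart_vector U \<phi> p w" for i
    using basis_tangent[of i p] tangent_space_eq_chart_vectors[OF U] by blast
  then obtain w where w: "\<And>i. E i p = chart_vector U \<phi> p (w i)"
    by metis
  define L where "L = (\<lambda>u::real^3. \<Sum>i\<in>UNIV. u $ i *\<^sub>R w i)"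
  have cv: "chart_vector U \<phi> p (\<Sum>i\<in>J. u i *\<^sub>R w i) = (\<lambda>f. \<Sum>i\<in>J. u i * E i p f)"
    if "finite J" for J :: "3 set" and u
    using that
  proof induction
    case empty
    show ?case
      using chart_vector_linear_combination[OF U, of 0 0 0 0] by simp
  next
    case (insert i J)
    then show ?case
      using chart_vector_linear_combination[OF U, of "u i" "w i" 1 "\<Sum>i\<in>J. u i *\<^sub>R w i"]
      by (simp add: w)
  qed
  have L: "chart_vector U \<phi> p (L u) = (\<lambda>f. \<Sum>i\<in>UNIV. u $ i * E i p f)" for u
    unfolding L_def by (rule cv) simp
  have lin: "linear L"
    unfolding L_def by (intro linearI) (simp_all add: scaleR_add_left sum.distrib scaleR_sum_right)
  have "u = 0" if "L u = 0" for u
  proof -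
    have "chart_vector U \<phi> p 0 = (\<lambda>f. 0)"
      using chart_vector_linear_combination[OF U, of 0 0 0 0] by simp
    then have "(\<lambda>f. \<Sum>i\<in>UNIV. u $ i * E i p f) = (\<lambda>f. 0)"
      using L[of u] that by simp
    then have "u $ j = 0" for j
      using basis_sum_inner[of p "\<lambda>i. u $ i" j] metric_zero[OF basis_tangent] by simp
    then show ?thesis by (simp add: vec_eq_iff)
  qed
  then have "surj L"
    using linear_injective_imp_surjective[OF lin] linear_injective_0[OF lin] by blast
  moreover obtain z where "v = chart_vector U \<phi> p z"
    using v tangent_space_eq_chart_vectors[OF U] by blast
  ultimately obtain u where "v = (\<lambda>f. \<Sum>i\<in>UNIV. u $ i * E i p f)"
    using L by (metis surjD)
  then show ?thesis
    using basis_sum_inner[of p "\<lambda>i. u $ i"] by simp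
qed

lemma tangent_eq_zeroI:
  assumes "v \<in> tangent_space A p" "\<And>i. h p v (E i p) = 0"
  shows "v = (\<lambda>f. 0)"
  using frame_expansion[OF assms(1)] assms(2) by simp

lemma lie_algebra_expansion:
  assumes "X \<in> lie_algebra A"
  shows "X = (\<lambda>p f. \<Sum>i\<in>UNIV. coords h E X $ i * E i p f)"
proof
  show "X p = (\<lambda>f. \<Sum>i\<in>UNIV. coords h E X $ i * E i p f)" for p
    using frame_expansion[OF left_invariant_tangent[OF assms, of p]]
    by (simp add: coords_def left_invariant_inner[OF assms basis_lie_algebra])
qed

lemma coords_inner:
  assumes "X \<in> lie_algebra A" "Y \<in> lie_algebra A"
  shows "coords h E X \<bullet> coords h E Y = alg_inner h X Y"
proof -
  have "alg_inner h X Y = h 0 (\<lambda>f. \<Sum>i\<in>UNIV. coords h E X $ i * E i 0 f) (Y 0)"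
    using lie_algebra_expansion[OF assms(1)] unfolding alg_inner_def by metis
  also have "\<dots> = (\<Sum>i\<in>UNIV. coords h E X $ i * h 0 (E i 0) (Y 0))"
    by (rule metric_sum) (simp_all add: basis_tangent left_invariant_tangent assms)
  also have "\<dots> = coords h E X \<bullet> coords h E Y"
    unfolding inner_vec_def coords_def alg_inner_def
    by (simp add: metric_sym[OF basis_tangent left_invariant_tangent[OF assms(2)]])
  finally show ?thesis ..
qed


section \<open>The Levi-Civita connection\<close>

lemma
  assumes "smooth_vfield A X" "smooth_vfield A Y"
  shows nabla_smooth: "smooth_vfield A (nabla X Y)"
    and nabla_torsion_free: "(\<lambda>p \<xi>. nabla X Y p \<xi> - nabla Y X p \<xi>) = lie_bracket A X Y"
  using levi_civita assms smooth_fun_const unfolding levi_civita_def by blast+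

lemma
  assumes "smooth_vfield A X" "smooth_vfield A Y" "smooth_vfield A Z"
  shows nabla_combination: "smooth_fun A UNIV f \<Longrightarrow> smooth_fun A UNIV g \<Longrightarrow>
      nabla (\<lambda>p \<xi>. f p * X p \<xi> + g p * Y p \<xi>) Z
        = (\<lambda>p \<xi>. f p * nabla X Z p \<xi> + g p * nabla Y Z p \<xi>)"
    and nabla_add: "nabla X (\<lambda>p \<xi>. Y p \<xi> + Z p \<xi>) = (\<lambda>p \<xi>. nabla X Y p \<xi> + nabla X Z p \<xi>)"
    and nabla_leibniz: "smooth_fun A UNIV f \<Longrightarrow>
      nabla X (\<lambda>p \<xi>. f p * Y p \<xi>) = (\<lambda>p \<xi>. f p * nabla X Y p \<xi> + X p f * Y p \<xi>)"
    and nabla_metric: "X p (\<lambda>q. h q (Y q) (Z q)) = h p (nabla X Y p) (Z p) + h p (Y p) (nabla X Z p)"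
  using levi_civita assms smooth_fun_const unfolding levi_civita_def by blast+

lemma basis_smooth: "smooth_vfield A (E i)"
  by (rule lie_algebraD(1)[OF basis_lie_algebra])

lemma nabla_tangent:
  "smooth_vfield A X \<Longrightarrow> smooth_vfield A Y \<Longrightarrow> nabla X Y p \<in> tangent_space A p"
  using nabla_smooth smooth_vfieldD(1) by blast

lemma nabla_sum_left:
  assumes Y: "smooth_vfield A Y" and a: "\<And>i. smooth_fun A UNIV (a i)" and J: "finite J"
  shows "nabla (\<lambda>p \<xi>. \<Sum>i\<in>J. a i p * E i p \<xi>) Y = (\<lambda>p \<xi>. \<Sum>i\<in>J. a i p * nabla (E i) Y p \<xi>)"
  using J
proof induction
  case empty
  show ?case
    using nabla_combination[OF Y Y Y smooth_fun_const smooth_fun_const, of 0 0] by simp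
next
  case (insert i J)
  have "smooth_vfield A (\<lambda>p \<xi>. \<Sum>i\<in>J. a i p * E i p \<xi>)"
    by (intro smooth_vfield_sum a basis_smooth)
  from nabla_combination[OF basis_smooth this Y a smooth_fun_const, of i i 1]
  show ?case using insert by simp
qed

lemma nabla_sum_right:
  assumes X: "smooth_vfield A X" and J: "finite J"
  shows "nabla X (\<lambda>p \<xi>. \<Sum>i\<in>J. c i * E i p \<xi>) = (\<lambda>p \<xi>. \<Sum>i\<in>J. c i * nabla X (E i) p \<xi>)"
  using J
proof induction
  case empty
  show ?case
    using nabla_leibniz[OF X X X smooth_fun_const[of 0]] tangent_vector_const[OF smooth_vfieldD(1)[OF X]]
    by simp
next
  case (insert i J)
  have "smooth_vfield A (\<lambda>p \<xi>. \<Sum>i\<in>J. c i * E i p \<xi>)"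
    by (intro smooth_vfield_sum smooth_fun_const basis_smooth)
  moreover have "smooth_vfield A (\<lambda>p \<xi>. c i * E i p \<xi>)"
    using smooth_vfield_sum[of "{i}" "\<lambda>i p. c i" E] smooth_fun_const basis_smooth by simp
  moreover have "nabla X (\<lambda>p \<xi>. c i * E i p \<xi>) = (\<lambda>p \<xi>. c i * nabla X (E i) p \<xi>)"
    using nabla_leibniz[OF X basis_smooth[of i] X smooth_fun_const[of "c i"]]
      tangent_vector_const[OF smooth_vfieldD(1)[OF X]]
    by simp
  ultimately show ?case using insert nabla_add[OF X] by simp
qed

text \<open>The connection is linear over smooth functions in its first argument, and the left-invariant frame
  is globally defined. Expanding the field in this frame gives global smooth coefficients, whose
  values at \<open>p\<close> depend only on the value of the field at \<open>p\<close>.\<close>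

lemma nabla_tensorial:
  assumes U: "smooth_vfield A U" and W: "smooth_vfield A W" and Y: "smooth_vfield A Y"
    and eq: "U p = W p"
  shows "nabla U Y p = nabla W Y p"
proof -
  have *: "nabla V Y p = (\<lambda>\<xi>. \<Sum>i\<in>UNIV. h p (V p) (E i p) * nabla (E i) Y p \<xi>)"
    if V: "smooth_vfield A V" for V
  proof -
    have "V = (\<lambda>p \<xi>. \<Sum>i\<in>UNIV. h p (V p) (E i p) * E i p \<xi>)"
      using frame_expansion[OF smooth_vfieldD(1)[OF V]] by blast
    then have "nabla V Y = nabla (\<lambda>p \<xi>. \<Sum>i\<in>UNIV. h p (V p) (E i p) * E i p \<xi>) Y"
      by (rule arg_cong)
    also have "\<dots> = (\<lambda>p \<xi>. \<Sum>i\<in>UNIV. h p (V p) (E i p) * nabla (E i) Y p \<xi>)"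
      by (rule nabla_sum_left[OF Y metric_smooth[OF V basis_smooth]]) simp
    finally show ?thesis by (rule fun_cong)
  qed
  show ?thesis unfolding *[OF U] *[OF W] eq ..
qed

text \<open>The inner product of two left-invariant fields is constant, so its derivative vanishes.\<close>

lemma nabla_skew:
  assumes X: "smooth_vfield A X" and Y: "Y \<in> lie_algebra A" and Z: "Z \<in> lie_algebra A"
  shows "h p (nabla X Y p) (Z p) = - h p (Y p) (nabla X Z p)"
  using nabla_metric[OF X lie_algebraD(1)[OF Y] lie_algebraD(1)[OF Z], of p]
    tangent_vector_const[OF smooth_vfieldD(1)[OF X]]
  by (simp add: left_invariant_inner[OF Y Z])

text \<open>Let \<open>R\<close> be the right-invariant field with \<open>R p = Y p\<close>. Right-invariance of the metric makes the
  length of \<open>R\<close> constant, so \<open>\<nabla>\<^sub>X R\<close> is orthogonal to \<open>R\<close> for every left-invariant \<open>X\<close>. Since \<open>X\<close> and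
  \<open>R\<close> commute at \<open>p\<close>, \<open>\<nabla>\<^sub>X R\<close> and \<open>\<nabla>\<^sub>R X\<close> agree there, and the latter is \<open>\<nabla>\<^sub>Y X\<close> because it depends on
  the value \<open>R p\<close> only. Thus \<open>\<nabla>\<^sub>Y X\<close> is orthogonal to \<open>Y\<close>, which says that \<open>\<nabla>\<^sub>Y Y\<close> is orthogonal to
  \<open>X\<close>. With \<open>X\<close> ranging over the frame, \<open>\<nabla>\<^sub>Y Y = 0\<close>.\<close>

lemma nabla_self_eq_zero:
  assumes Y: "Y \<in> lie_algebra A"
  shows "nabla Y Y p = (\<lambda>f. 0)"
proof (rule tangent_eq_zeroI)
  note sY = lie_algebraD(1)[OF Y]
  show "nabla Y Y p \<in> tangent_space A p"
    by (rule nabla_tangent[OF sY sY])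
  fix i
  note Yp = left_invariant_tangent[OF Y, of p]
  let ?R = "right_invariant p (Y p)"
  have R: "smooth_vfield A ?R" and Rp: "?R p = Y p"
    by (rule right_invariant_smooth[OF Yp], rule right_invariant_base[OF Yp])
  have "nabla (E i) ?R p \<xi> - nabla ?R (E i) p \<xi> = 0" for \<xi>
    using nabla_torsion_free[OF basis_smooth R, of i]
      left_right_invariant_commute[OF basis_lie_algebra Yp, of i]
    by (simp add: fun_eq_iff)
  then have "nabla (E i) ?R p = nabla ?R (E i) p"
    by (simp add: fun_eq_iff)
  also have "\<dots> = nabla Y (E i) p"
    by (rule nabla_tensorial[OF R sY basis_smooth Rp])
  finally have 1: "nabla (E i) ?R p = nabla Y (E i) p" .
  have "0 = E i p (\<lambda>q. h q (?R q) (?R q))"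
    unfolding right_invariant_inner[OF Yp Yp]
    by (rule tangent_vector_const[OF basis_tangent, symmetric])
  also have "\<dots> = h p (nabla (E i) ?R p) (?R p) + h p (?R p) (nabla (E i) ?R p)"
    by (rule nabla_metric[OF basis_smooth R R])
  also have "\<dots> = 2 * h p (nabla Y (E i) p) (Y p)"
    unfolding 1 Rp using metric_sym[OF Yp nabla_tangent[OF sY basis_smooth]] by simp
  also have "\<dots> = - 2 * h p (E i p) (nabla Y Y p)"
    using nabla_skew[OF sY basis_lie_algebra Y] by simp
  finally show "h p (nabla Y Y p) (E i p) = 0"
    using metric_sym[OF basis_tangent nabla_tangent[OF sY sY]] by simp
qed


section \<open>The principal normal of the conjugate mate\<close>

lemma cov_deriv_eq:
  assumes T: "T t \<in> lie_algebra A" and U: "U t \<in> lie_algebra A"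
  shows "cov_deriv h nabla E I \<gamma> T U t = (\<lambda>f. (\<Sum>i\<in>UNIV.
    vector_derivative (\<lambda>s. coords h E (U s) $ i) (at t within I) * E i (\<gamma> t) f)
    + nabla (T t) (U t) (\<gamma> t) f)"
proof -
  have "nabla (T t) (U t) = nabla (T t) (\<lambda>p f. \<Sum>i\<in>UNIV. coords h E (U t) $ i * E i p f)"
    using lie_algebra_expansion[OF U] by (rule arg_cong)
  also have "\<dots> = (\<lambda>p f. \<Sum>i\<in>UNIV. coords h E (U t) $ i * nabla (T t) (E i) p f)"
    by (rule nabla_sum_right[OF lie_algebraD(1)[OF T]]) simp
  finally show ?thesis
    unfolding cov_deriv_def by (simp add: sum.distrib)
qed

lemma orthonormal_normal_direction:
  fixes T N B b :: "real^3"
  assumes "T \<bullet> T = 1" "N \<bullet> N = 1" "B \<bullet> B = 1" "T \<bullet> N = 0" "T \<bullet> B = 0" "N \<bullet> B = 0"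
    and b: "b \<bullet> T = 0" "b \<bullet> B = 0"
  shows "b = (b \<bullet> N) *\<^sub>R N"
proof -
  let ?S = "{T, N, B}"
  have o: "pairwise orthogonal ?S"
    using assms by (auto simp: pairwise_def orthogonal_def inner_commute)
  have "0 \<notin> ?S" using assms by auto
  then have ind: "independent ?S"
    by (rule pairwise_orthogonal_independent[OF o])
  have "card ?S = 3"
    using assms by (auto simp: card_insert_if)
  then have "span ?S = UNIV"
    using card_ge_dim_independent[of ?S UNIV, OF _ ind] by auto
  moreover have "orthogonal (b - (b \<bullet> N) *\<^sub>R N) y" if "y \<in> ?S" for y
    using that assms by (auto simp: orthogonal_def inner_diff_left inner_diff_right inner_commute)
  ultimately have "orthogonal (b - (b \<bullet> N) *\<^sub>R N) (b - (b \<bullet> N) *\<^sub>R N)"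
    using orthogonal_to_span by (metis UNIV_I orthogonal_commute)
  then show ?thesis by (simp add: orthogonal_def)
qed

text \<open>Let \<open>b\<close> be the derivative of the coordinates of \<open>B\<close>. Along the first curve it equals
  \<open>- \<tau> N - \<nabla>\<^sub>T B\<close>, and \<open>\<nabla>\<^sub>T B\<close> is orthogonal to \<open>B\<close> and, because \<open>\<nabla>\<^sub>T T = 0\<close>, also to \<open>T\<close>; so \<open>b\<close> is a
  multiple \<open>l N\<close> of the normal. Along the mate, whose tangent is \<open>B\<close>, the term \<open>\<nabla>\<^sub>B B\<close> vanishes and \<open>b\<close> is
  the covariant derivative of the tangent, that is \<open>\<kappa>\<^sup>* N\<^sup>*\<close>. In general the two curves
  pass through different points at parameter \<open>t\<close>; the comparison is possible because \<open>b\<close> and the frames are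
  coordinate vectors, independent of the base point.\<close>

lemma conjugate_mate_normal:
  assumes F: "frenet_apparatus A h nabla E I \<gamma> F"
    and mate: "conjugate_mate A h nabla E I F \<gamma>' F'"
    and t: "t \<in> I"
  shows "lin_dependent (normal F t) (normal F' t)"
proof -
  have F': "frenet_apparatus A h nabla E I \<gamma>' F'" and TB: "\<And>s. s \<in> I \<Longrightarrow> tangent F' s = binormal F s"
    using mate unfolding conjugate_mate_def by blast+
  let ?T = "tangent F t" and ?N = "normal F t" and ?B = "binormal F t" and ?N' = "normal F' t"
  have la: "?T \<in> lie_algebra A" "?N \<in> lie_algebra A" "?B \<in> lie_algebra A"
    and frame: "alg_inner h ?T ?T = 1" "alg_inner h ?N ?N = 1" "alg_inner h ?B ?B = 1"
      "alg_inner h ?T ?N = 0" "alg_inner h ?T ?B = 0" "alg_inner h ?N ?B = 0"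
    and DB: "cov_deriv h nabla E I \<gamma> (tangent F) (binormal F) t = (\<lambda>f. - torsion F t * ?N (\<gamma> t) f)"
    using F t unfolding frenet_apparatus_def Let_def by blast+
  have la': "tangent F' t \<in> lie_algebra A" "?N' \<in> lie_algebra A"
    and k: "curvature F' t > 0"
    and DT': "cov_deriv h nabla E I \<gamma>' (tangent F') (tangent F') t = (\<lambda>f. curvature F' t * ?N' (\<gamma>' t) f)"
    using F' t unfolding frenet_apparatus_def Let_def by blast+
  define b where "b = (\<chi> i. vector_derivative (\<lambda>s. coords h E (binormal F s) $ i) (at t within I))"
  let ?b = "\<lambda>p f. \<Sum>i\<in>UNIV. b $ i * E i p f"
  note sT = lie_algebraD(1)[OF la(1)] and sB = lie_algebraD(1)[OF la(3)]
  let ?p = "\<gamma> t" and ?q = "\<gamma>' t"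
  have b_tan: "?b p \<in> tangent_space A p" for p
    by (rule tangent_space_sum[OF basis_tangent])
  have b_inner: "h p (?b p) (X p) = b \<bullet> coords h E X" if X: "X \<in> lie_algebra A" for p X
    using metric_sum[OF left_invariant_tangent[OF X, of p], where J = UNIV and v = "\<lambda>i. E i p"
        and c = "\<lambda>i. b $ i"]
      left_invariant_inner[OF X basis_lie_algebra, of p]
      metric_sym[OF basis_tangent left_invariant_tangent[OF X, of p]]
    by (simp add: basis_tangent inner_vec_def coords_def)
  \<comment> \<open>The third Frenet equation of the first curve, read at \<open>\<gamma> t\<close>.\<close>
  have "?b ?p = (\<lambda>f. - torsion F t * ?N ?p f + (-1) * nabla ?T ?B ?p f)"
    using DB unfolding cov_deriv_eq[of "tangent F" t "binormal F", OF la(1,3)]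
    by (simp add: b_def fun_eq_iff eq_diff_eq)
  then have b_eq: "h ?p (?b ?p) (X ?p) = - torsion F t * alg_inner h ?N X - h ?p (nabla ?T ?B ?p) (X ?p)"
    if X: "X \<in> lie_algebra A" for X
    using metric_linear_combination[OF left_invariant_tangent[OF la(2)] nabla_tangent[OF sT sB]
        left_invariant_tangent[OF X], of ?p "- torsion F t" "-1"]
      left_invariant_inner[OF la(2) X, of ?p] by simp
  have "h ?p (nabla ?T ?B ?p) (?B ?p) = 0"
    using nabla_skew[OF sT la(3,3), of ?p]
      metric_sym[OF left_invariant_tangent[OF la(3)] nabla_tangent[OF sT sB], of ?p] by simp
  then have bB: "b \<bullet> coords h E ?B = 0"
    using b_eq[OF la(3)] b_inner[OF la(3)] frame by simp
  have "h ?p (nabla ?T ?B ?p) (?T ?p) = - h ?p (?B ?p) (\<lambda>f. 0)"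
    using nabla_skew[OF sT la(3,1), of ?p] nabla_self_eq_zero[OF la(1), of ?p] by simp
  also have "\<dots> = 0"
    using metric_sym[OF left_invariant_tangent[OF la(3)] tangent_space_zero, of ?p]
      metric_zero[OF left_invariant_tangent[OF la(3)], of ?p] by simp
  finally have bT: "b \<bullet> coords h E ?T = 0"
    using b_eq[OF la(1)] b_inner[OF la(1)] frame metric_sym[OF left_invariant_tangent[OF la(1)]
      left_invariant_tangent[OF la(2)], of 0] by (simp add: alg_inner_def)
  define l where "l = b \<bullet> coords h E ?N"
  have bN: "b = l *\<^sub>R coords h E ?N"
    unfolding l_def
    by (rule orthonormal_normal_direction[of "coords h E ?T" _ "coords h E ?B"])
       (simp_all add: coords_inner la frame bT bB)
  \<comment> \<open>The first Frenet equation of the mate, read at \<open>\<gamma>' t\<close>.\<close>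
  have "?b ?q = (\<lambda>f. curvature F' t * ?N' ?q f)"
  proof -
    have "vector_derivative (\<lambda>s. coords h E (tangent F' s) $ i) (at t within I) = b $ i" for i
      unfolding b_def vec_lambda_beta
      by (rule vector_derivative_cong_eq) (use t TB in auto)
    then show ?thesis
      using DT' unfolding cov_deriv_eq[of "tangent F'" t "tangent F'", OF la'(1,1)]
      by (simp add: nabla_self_eq_zero[OF la'(1)])
  qed
  then have "h ?q (\<lambda>f. curvature F' t * ?N' ?q f + 0 * ?N' ?q f) (E i ?q) = b $ i" for i
    using basis_sum_inner[of ?q "\<lambda>i. b $ i" i] by simp
  then have "curvature F' t * coords h E ?N' $ i = b $ i" for i
    using metric_linear_combination[OF left_invariant_tangent[OF la'(2)]
        left_invariant_tangent[OF la'(2)] basis_tangent, of ?q "curvature F' t" 0 i]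
      left_invariant_inner[OF la'(2) basis_lie_algebra, of ?q i] by (simp add: coords_def)
  then have key: "l * coords h E ?N $ i = curvature F' t * coords h E ?N' $ i" for i
    using bN by simp
  have "l * ?N p f + - curvature F' t * ?N' p f = 0" for p f
  proof -
    have "l * ?N p f = (\<Sum>i\<in>UNIV. l * coords h E ?N $ i * E i p f)"
      by (subst lie_algebra_expansion[OF la(2)]) (simp add: sum_distrib_left mult.assoc)
    also have "\<dots> = (\<Sum>i\<in>UNIV. curvature F' t * coords h E ?N' $ i * E i p f)"
      by (simp only: key)
    also have "\<dots> = curvature F' t * ?N' p f"
      by (subst (2) lie_algebra_expansion[OF la'(2)]) (simp add: sum_distrib_left mult.assoc)
    finally show ?thesis by simp
  qed
  then show ?thesis
    unfolding lin_dependent_def using k by (intro exI[of _ l] exI[of _ "- curvature F' t"]) auto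
qed

end


section \<open>Bertrand couples\<close>

theorem corollary6p4:
  fixes A :: "'g::{topological_group_add, t2_space, second_countable_topology} chart set"
    and h :: "'g \<Rightarrow> 'g tangent \<Rightarrow> 'g tangent \<Rightarrow> real"
    and nabla :: "'g vfield \<Rightarrow> 'g vfield \<Rightarrow> 'g vfield"
    and E :: "3 \<Rightarrow> 'g vfield"
    and I :: "real set"
    and \<gamma> \<gamma>' :: "real \<Rightarrow> 'g"
    and F F' :: "'g frenet"
  assumes "lie_group A"
    and "bi_invariant_metric A h"
    and "levi_civita A h nabla"
    and "orthonormal_basis A h E"
    and "is_interval I" and "interior I \<noteq> {}"
    and "frenet_curve A h nabla E I \<gamma> F"
    and "\<forall>t\<in>I. torsion F t - lie_torsion A h F t \<noteq> 0"
    and "conjugate_mate A h nabla E I F \<gamma>' F'"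
  shows "bertrand_couple A h nabla E I \<gamma> F \<gamma>' F'"
proof -
  interpret lie_group_bi_invariant A h nabla E
    by unfold_locales fact+
  have F: "frenet_apparatus A h nabla E I \<gamma> F"
    using assms unfolding frenet_curve_def by blast
  moreover have "frenet_apparatus A h nabla E I \<gamma>' F'"
    using assms unfolding conjugate_mate_def by blast
  moreover have "\<forall>t\<in>I. lin_dependent (normal F t) (normal F' t)"
    using conjugate_mate_normal[OF F] assms by blast
  ultimately show ?thesis
    unfolding bertrand_couple_def by blast
qed

end
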